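(* Let $A:\mathbb{R}^n\to\mathbb{R}^m$ be linear, $\mathcal{C}\subseteq\mathbb{R}^n$ a nonempty polyhedral convex set, $f:\mathbb{R}^n\to\mathbb{R}$ continuously differentiable, and $g:\mathbb{R}^m\to\mathbb{R}\cup\{\infty\}$ polyhedral convex, with $\mathrm{dom}\,g\cap A(\mathrm{ri}(\mathcal{C}))\neq\emptyset$. Let $(\bar x,\bar\lambda)\in\mathbb{R}^n\times\mathbb{R}^m$ satisfy: (i) $0\in\partial\delta_{\mathcal{C}}(\bar x)+\nabla f(\bar x)+A^\top\bar\lambda$ and $\bar\lambda\in\partial g(A\bar x)$; (ii) there exists a convex neighborhood $U_{\bar x}$ of $\bar x$ on which $\nabla^2 f$ exists and is continuous, and $\nabla^2 f(\bar x)$ is positive definite relative to the subspace $V_{\mathcal{C}}\cap\mathcal{S}_A(\bar x\mid\bar\lambda)$. Then there exists $\beta_0>0$ such that, for every $\beta>2\beta_0$, there exist closed convex neighborhoods $\mathcal{X}_\beta$ and $\Lambda_\beta$ of $\bar x$ and $\bar\lambda$, respectively, and a constant $\rho_\beta>0$ with $\mathbb{B}(\bar\lambda,\rho_\beta)\subseteq\mathrm{int}\,\Lambda_\beta$, such that the following holds for every well-defined sequence $\{(x^k,y^k,\lambda^k):k\in\mathbb{N}\}$ generated by the ADMM scheme with penalty parameter $\beta$ that satisfies $$\lambda^0\in\partial g(y^0),\qquad \beta^2\|y^0-A\bar x\|^2+\|\lambda^0-\bar\lambda\|^2\le\rho_\beta^2,\qquad x^k\in\mathcal{X}_\beta\ \text{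 for all }k\ge1.$$ Put $\Lambda^*_\beta:=\{\lambda\in\Lambda_\beta\mid 0\in\nabla f(\bar x)+A^\top\lambda+N_{\mathcal{C}}(\bar x),\ \lambda\in\partial g(A\bar x)\}$, $v^k:=(y^k,\lambda^k)$ and $\mathcal{V}^*:=\{A\bar x\}\times\Lambda^*_\beta$. Then: (a) $x^k\to\bar x$, $y^k\to A\bar x$, and $\lambda^k\to\widehat\lambda$ for some $\widehat\lambda\in\Lambda^*_\beta\cap\mathbb{B}(\bar\lambda,\rho_\beta)$; (b) $\mathrm{dist}_\beta(v^k,\mathcal{V}^* )$ converges Q-linearly to $0$, and consequently $\mathrm{dist}(v^k,\mathcal{V}^* )$ converges R-linearly (to $0$) and $\{x^k\}$ converges R-linearly (to $\bar x$).
   Context: The ADMM scheme with penalty parameter $\beta>0$ for $\min_{x\in\mathcal{C}}f(x)+g(Ax)$ is, for $k=0,1,2,\dots$, $$\begin{aligned} x^{k+1}&\in\arg\min_{x\in\mathcal{C}} f(x)+\langle\lambda^k,Ax\rangle+\tfrac{\beta}{2}\|Ax-y^k\|^2,\\ y^{k+1}&=\arg\min_y g(y)+\langle\lambda^k,-y\rangle+\tfrac{\beta}{2}\|Ax^{k+1}-y\|^2,\\ \lambda^{k+1}&=\lambda^k+\beta(Ax^{k+1}-y^{k+1}). \end{aligned}$$ "Well-defined" means that the minimizers in the $x$-step exist at every iteration. For $v=(y,\lambda)\in\mathbb{R}^m\times\mathbb{R}^m$ and a nonempty closed set $\mathcal{V}\subseteq\mathbb{R}^m\times\mathbb{R}^m$: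 $\|v\|_\beta^2:=\beta\|y\|^2+\frac1\beta\|\lambda\|^2$ and $\mathrm{dist}_\beta(v,\mathcal{V}):=\inf_{\widehat v\in\mathcal{V}}\|v-\widehat v\|_\beta$; $\mathrm{dist}$ is the Euclidean distance to a set. A sequence $z^k\to z^*$ converges Q-linearly if there is $\rho\in(0,1)$ with $\limsup_{k\to\infty}\|z^{k+1}-z^*\|/\|z^k-z^*\|\le\rho$ (convention $0/0=0$). It converges R-linearly if there is a nonnegative sequence $\{\varepsilon_k\}$ converging Q-linearly to zero with $\|z^k-z^*\|\le\varepsilon_k$ for all sufficiently large $k$; equivalently $\|z^k-z^*\|\le\alpha\rho^k$ for some $\alpha>0$, $\rho\in(0,1)$. A polyhedral convex set is a finite intersection of closed half-spaces; a polyhedral convex function is a convex function whose epigraph is a polyhedral convex set. $\delta_{\mathcal{C}}$ is the indicator function of $\mathcal{C}$; $\partial$ is the convex subdifferential; $N_{\mathcal{C}}(x)=\partial\delta_{\mathcal{C}}(x)$ is the normal cone; $\mathbb{B}(x,r)$ is the closed Euclidean ball. $V_{\mathcal{C}}=\mathrm{aff}_{\mathcal{C}}-x$ (any $x\in\mathcal{C}$) is the linear subspace parallel to the affine hull of $\mathcal{C}$. For $\lambda\in\partial g(y)$, $T_g(y\mid\lambda):=\{w\mid g'(y;w)=\langle\lambda,w\rangle\}$ with $g'(y;w)$ the one-sided directional derivative; $\mathcal{S}(y\mid\lambda):=T_g(y\mid\lambda)-T_g(y\mid\lambda)$ (the set of differences, the smallest subspace containing the cone $T_g(y\mid\lambda)$);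 $\mathcal{S}_A(\bar x\mid\bar\lambda):=\{v\in\mathbb{R}^n\mid Av\in\mathcal{S}(A\bar x\mid\bar\lambda)\}$. A symmetric matrix $H$ is positive definite relative to a subspace $V$ if $v^\top Hv>0$ for all $0\neq v\in V$. *)

theory Defs
  imports "HOL-Analysis.Analysis"
begin

section \<open>Convex analysis for extended-real-valued functions\<close>

definition eff_dom :: "('a \<Rightarrow> ereal) \<Rightarrow> 'a set" where
  "eff_dom g = {y. g y < \<infinity>}"

text \<open>The library constant \<^const>\<open>epigraph\<close> only covers real-valued functions.\<close>

definition ereal_epigraph :: "('a \<Rightarrow> ereal) \<Rightarrow> ('a \<times> real) set" where
  "ereal_epigraph g = {(y, t). g y \<le> ereal t}"

text \<open>Functions with values in \<open>\<real> \<union> {\<infinity>}\<close>; an extended-real-valued function is convex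
  iff its epigraph is. The convexity conjunct is implied by the last one.\<close>

definition polyhedral_convex_fun :: "('a::euclidean_space \<Rightarrow> ereal) \<Rightarrow> bool" where
  "polyhedral_convex_fun g \<longleftrightarrow>
     (\<forall>y. g y \<noteq> - \<infinity>) \<and> convex (ereal_epigraph g) \<and> polyhedron (ereal_epigraph g)"

definition subdifferential :: "('a::real_inner \<Rightarrow> ereal) \<Rightarrow> 'a \<Rightarrow> 'a set" where
  "subdifferential g y =
     {s. \<bar>g y\<bar> \<noteq> \<infinity> \<and> (\<forall>z. g y + ereal (s \<bullet> (z - y)) \<le> g z)}"

definition delta_fun :: "'a set \<Rightarrow> 'a \<Rightarrow> ereal" where
  "delta_fun C x = (if x \<in> C then 0 else \<infinity>)"

definition normal_cone :: "'a::real_inner set \<Rightarrow> 'a \<Rightarrow> 'a set" where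
  "normal_cone C x = subdifferential (delta_fun C) x"

text \<open>For convex \<open>g\<close> finite at \<open>y\<close> the limit exists in the extended reals.\<close>

definition dir_deriv :: "('a::real_normed_vector \<Rightarrow> ereal) \<Rightarrow> 'a \<Rightarrow> 'a \<Rightarrow> ereal" where
  "dir_deriv g y w = Lim (at_right 0) (\<lambda>t. (g (y + t *\<^sub>R w) - g y) / ereal t)"

definition T_cone :: "('a::real_inner \<Rightarrow> ereal) \<Rightarrow> 'a \<Rightarrow> 'a \<Rightarrow> 'a set" where
  "T_cone g y l = {w. dir_deriv g y w = ereal (l \<bullet> w)}"

definition S_space :: "('a::real_inner \<Rightarrow> ereal) \<Rightarrow> 'a \<Rightarrow> 'a \<Rightarrow> 'a set" where
  "S_space g y l = {u - w |u w. u \<in> T_cone g y l \<and> w \<in> T_cone g y l}"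

definition S_space_pre ::
  "real^'n^'m \<Rightarrow> (real^'m \<Rightarrow> ereal) \<Rightarrow> real^'n \<Rightarrow> real^'m \<Rightarrow> (real^'n) set" where
  "S_space_pre A g x l = {v. A *v v \<in> S_space g (A *v x) l}"

definition parallel_space :: "'a::real_vector set \<Rightarrow> 'a set" where
  "parallel_space C = (\<lambda>z. z - (SOME x. x \<in> C)) ` (affine hull C)"

lemma parallel_space_eq:
  fixes C :: "'a::real_vector set"
  assumes "x \<in> C"
  shows "parallel_space C = (\<lambda>z. z - x) ` (affine hull C)"
proof -
  define p where "p = (SOME x. x \<in> C)"
  have p: "p \<in> affine hull C"
    unfolding p_def by (rule hull_inc, rule someI[of "\<lambda>x. x \<in> C"], rule assms)
  have x: "x \<in> affine hull C"
    using assms by (rule hull_inc)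
  have shift: "z - a + b \<in> affine hull C"
    if "z \<in> affine hull C" "a \<in> affine hull C" "b \<in> affine hull C" for z a b
    using mem_affine_3_minus[OF affine_affine_hull that(3) that(1) that(2), of 1]
    by (simp add: algebra_simps)
  have "(\<lambda>z. z - a) ` (affine hull C) \<subseteq> (\<lambda>z. z - b) ` (affine hull C)"
    if "a \<in> affine hull C" "b \<in> affine hull C" for a b
  proof
    fix w assume "w \<in> (\<lambda>z. z - a) ` (affine hull C)"
    then obtain z where "z \<in> affine hull C" "w = z - a" by blast
    then have "w = (z - a + b) - b" "z - a + b \<in> affine hull C"
      using shift that by auto
    then show "w \<in> (\<lambda>z. z - b) ` (affine hull C)" by blast
  qed
  from this[OF p x] this[OF x p] show ?thesis
    unfolding parallel_space_def p_def by blast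
qed

text \<open>Symmetry of \<open>H\<close> is not part of the definition; a continuous Hessian is symmetric anyway.\<close>

definition pos_def_on :: "real^'n^'n \<Rightarrow> (real^'n) set \<Rightarrow> bool" where
  "pos_def_on H V \<longleftrightarrow> (\<forall>v\<in>V. v \<noteq> 0 \<longrightarrow> v \<bullet> (H *v v) > 0)"

section \<open>Optimality system and ADMM\<close>

text \<open>The argument \<open>gradf\<close> is the gradient of the smooth objective term.\<close>

definition kkt ::
  "real^'n^'m \<Rightarrow> (real^'n) set \<Rightarrow> (real^'n \<Rightarrow> real^'n) \<Rightarrow> (real^'m \<Rightarrow> ereal)
     \<Rightarrow> real^'n \<Rightarrow> real^'m \<Rightarrow> bool" where
  "kkt A C gradf g x l \<longleftrightarrow>
     0 \<in> (+) (gradf x + transpose A *v l) ` normal_cone C x \<and>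
     l \<in> subdifferential g (A *v x)"

text \<open>The component \<open>x 0\<close> is unconstrained. For proper closed convex \<open>g\<close> the minimizer in
  the \<open>y\<close>-step is unique.\<close>

definition admm ::
  "real^'n^'m \<Rightarrow> (real^'n) set \<Rightarrow> (real^'n \<Rightarrow> real) \<Rightarrow> (real^'m \<Rightarrow> ereal) \<Rightarrow> real
     \<Rightarrow> (nat \<Rightarrow> real^'n) \<Rightarrow> (nat \<Rightarrow> real^'m) \<Rightarrow> (nat \<Rightarrow> real^'m) \<Rightarrow> bool" where
  "admm A C f g \<beta> x y l \<longleftrightarrow> (\<forall>k.
     is_arg_min (\<lambda>u. f u + l k \<bullet> (A *v u) + \<beta> / 2 * (norm (A *v u - y k))\<^sup>2)
       (\<lambda>u. u \<in> C) (x (Suc k)) \<and>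
     is_arg_min (\<lambda>w. g w + ereal (l k \<bullet> (- w)) + ereal (\<beta> / 2 * (norm (A *v x (Suc k) - w))\<^sup>2))
       (\<lambda>w. True) (y (Suc k)) \<and>
     l (Suc k) = l k + \<beta> *\<^sub>R (A *v x (Suc k) - y (Suc k)))"

section \<open>Weighted distance and convergence rates\<close>

definition norm_beta :: "real \<Rightarrow> 'a::real_normed_vector \<times> 'a \<Rightarrow> real" where
  "norm_beta \<beta> v = sqrt (\<beta> * (norm (fst v))\<^sup>2 + 1 / \<beta> * (norm (snd v))\<^sup>2)"

definition dist_beta ::
  "real \<Rightarrow> 'a::real_normed_vector \<times> 'a \<Rightarrow> ('a \<times> 'a) set \<Rightarrow> real" where
  "dist_beta \<beta> v V = (INF w\<in>V. norm_beta \<beta> (v - w))"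

text \<open>The quotient is taken in \<^typ>\<open>ereal\<close>, where \<open>0 / 0 = 0\<close> and \<open>c / 0 = \<infinity>\<close> for \<open>c > 0\<close>;
  division on \<^typ>\<open>real\<close> would give \<open>c / 0 = 0\<close>.\<close>

definition Q_linear :: "(nat \<Rightarrow> 'a::real_normed_vector) \<Rightarrow> 'a \<Rightarrow> bool" where
  "Q_linear z zs \<longleftrightarrow> z \<longlonglongrightarrow> zs \<and>
     (\<exists>\<rho>. 0 < \<rho> \<and> \<rho> < 1 \<and>
        limsup (\<lambda>k. ereal (norm (z (Suc k) - zs)) / ereal (norm (z k - zs))) \<le> ereal \<rho>)"

definition R_linear :: "(nat \<Rightarrow> 'a::real_normed_vector) \<Rightarrow> 'a \<Rightarrow> bool" where
  "R_linear z zs \<longleftrightarrow>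
     (\<exists>\<epsilon>::nat \<Rightarrow> real. (\<forall>k. 0 \<le> \<epsilon> k) \<and> Q_linear \<epsilon> 0 \<and>
        (\<forall>\<^sub>F k in sequentially. norm (z k - zs) \<le> \<epsilon> k))"

end

theory Submission
  imports Defs
begin

text \<open>
  Why the theorem holds. Write \<open>ybar = A *v xbar\<close>. The optimality conditions of the two subproblems
  say that \<open>- (gradf x' + A\<^sup>T (l' + \<beta> (y' - y)))\<close> is normal to \<open>C\<close> at \<open>x'\<close> and that
  \<open>l' \<in> \<partial>g(y')\<close>. For convex \<open>f\<close>, monotonicity of the normal cone and of \<open>\<partial>g\<close> yields the
  classical Fejer inequality: the squared weighted distance of \<open>(y, l)\<close> to \<open>(ybar, l*)\<close> drops by at
  least the squared weighted step length, for every multiplier \<open>l*\<close>. Here \<open>f\<close> need not be convex and the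
  inequality carries the extra term \<open>2 * (gradf x' - gradf xbar) \<bullet> (x' - xbar)\<close>
  (\<open>admm_step_Fejer\<close>), which has to be bounded below.

  Polyhedrality of \<open>g\<close> makes this possible: close to the solution, \<open>y' - ybar\<close> is in a closed
  cone \<open>K\<close> inside the critical cone \<open>T\<^sub>g(ybar | lbar)\<close> (\<open>subdifferential_graph_near\<close>). As
  the Hessian is positive definite on the directions \<open>v\<close> parallel to \<open>C\<close> with \<open>A *v v\<close> in the span
  of the critical cone, a compactness argument gives \<open>v \<bullet> Hv + b |Av - w|\<^sup>2 \<ge> c |v|\<^sup>2\<close> for
  all \<open>v\<close> parallel to \<open>C\<close> and \<open>w \<in> K\<close> (\<open>penalized_form_coercive\<close>). With \<open>v = x' - xbar\<close> and
  \<open>w = y' - ybar\<close> the penalty is the squared primal residual, i.e. \<open>|l' - l|\<^sup>2 / \<beta>\<^sup>2\<close>, and the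
  Fejer inequality contains the term \<open>|l' - l|\<^sup>2 / \<beta>\<close>. It absorbs the
  penalty exactly when \<open>\<beta> > 2 * b\<close>, and what remains is a decrease proportional to the square of
  \<open>|x' - xbar| + |y' - y| + |l' - l|\<close>.

  The same quantity bounds the new distance. Indeed \<open>l'\<close> and the normal vector at \<open>x'\<close> lie in the
  polyhedra \<open>\<partial>g(ybar)\<close> and \<open>N\<^sub>C(xbar)\<close> (\<open>normal_cone_subset_near\<close>), and \<open>l'\<close> violates
  the stationarity equation at \<open>xbar\<close> only by \<open>O(|x' - xbar| + |y' - y|)\<close>. The multiplier set is
  a polyhedron, so Hoffman's bound (\<open>Hoffman\<close>, \<open>multiplier_error_bound\<close>) turns this residual into
  a distance. Decrease and error bound together give Q-linear convergence of the distance; the steps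
  are then geometrically small, which yields convergence of the multipliers and all other rates.
\<close>

section \<open>Polyhedra, finitely generated cones and Hoffman's error bound\<close>

lemma polyhedron_eq_inequalities:
  fixes P :: "'a::euclidean_space set"
  assumes "polyhedron P"
  obtains F :: "('a \<times> real) set" where "finite F" "P = {x. \<forall>i\<in>F. fst i \<bullet> x \<le> snd i}"
proof -
  obtain H where H: "finite H" "P = \<Inter> H"
      "\<forall>h\<in>H. \<exists>a b. a \<noteq> 0 \<and> h = {x. a \<bullet> x \<le> b}"
    using assms unfolding polyhedron_def by blast
  then have "\<forall>h\<in>H. \<exists>c. h = {x. fst c \<bullet> x \<le> snd c}" by (metis fst_conv snd_conv)
  from bchoice[OF this] obtain c where c: "\<forall>h\<in>H. h = {x. fst (c h) \<bullet> x \<le> snd (c h)}" ..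
  have "x \<in> P \<longleftrightarrow> (\<forall>h\<in>H. fst (c h) \<bullet> x \<le> snd (c h))" for x
    unfolding H(2) using c by blast
  then have "P = {x. \<forall>i\<in>c ` H. fst i \<bullet> x \<le> snd i}" by auto
  then show ?thesis using H(1) that by blast
qed

lemma polyhedron_inequalities:
  fixes a :: "'i \<Rightarrow> 'a::euclidean_space"
  assumes "finite I"
  shows "polyhedron {x. \<forall>i\<in>I. a i \<bullet> x \<le> b i}"
proof -
  have "{x. \<forall>i\<in>I. a i \<bullet> x \<le> b i} = \<Inter> ((\<lambda>i. {x. a i \<bullet> x \<le> b i}) ` I)" by blast
  then show ?thesis
    using assms by (auto intro!: polyhedron_Inter simp: polyhedron_halfspace_le)
qed

lemma adjoint_inner_left:
  fixes T :: "'a::euclidean_space \<Rightarrow> 'b::euclidean_space"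
  assumes "linear T"
  shows "adjoint T a \<bullet> x = a \<bullet> T x"
  using adjoint_works[OF assms, of x a] by (simp only: inner_commute)

lemma affine_vimage_eq_inequalities:
  fixes T :: "'a::euclidean_space \<Rightarrow> 'b::euclidean_space"
  assumes "linear T"
  shows "{x. T x + c \<in> {z. \<forall>i\<in>F. fst i \<bullet> z \<le> snd i}}
       = {x. \<forall>i\<in>F. adjoint T (fst i) \<bullet> x \<le> snd i - fst i \<bullet> c}"
  by (auto simp: adjoint_inner_left[OF assms] inner_add_right algebra_simps)

lemma polyhedron_affine_vimage:
  fixes T :: "'a::euclidean_space \<Rightarrow> 'b::euclidean_space"
  assumes "linear T" "polyhedron Q"
  shows "polyhedron {x. T x + c \<in> Q}"
proof -
  obtain F where F: "finite F" "Q = {x. \<forall>i\<in>F. fst i \<bullet> x \<le> snd i}"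
    using polyhedron_eq_inequalities[OF assms(2)] .
  show ?thesis
    unfolding F(2) affine_vimage_eq_inequalities[OF assms(1)]
    by (rule polyhedron_inequalities[OF F(1)])
qed

lemma polyhedron_Times:
  fixes P :: "'a::euclidean_space set" and Q :: "'b::euclidean_space set"
  assumes "polyhedron P" "polyhedron Q"
  shows "polyhedron (P \<times> Q)"
proof -
  have "P \<times> Q = {z. fst z + 0 \<in> P} \<inter> {z. snd z + 0 \<in> Q}"
    by (simp add: set_eq_iff mem_Times_iff)
  moreover have "polyhedron {z::'a \<times> 'b. fst z + 0 \<in> P}"
    by (rule polyhedron_affine_vimage[OF linear_fst assms(1)])
  moreover have "polyhedron {z::'a \<times> 'b. snd z + 0 \<in> Q}"
    by (rule polyhedron_affine_vimage[OF linear_snd assms(2)])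
  ultimately show ?thesis by (simp only: polyhedron_Int)
qed

lemma polyhedron_feasible_direction:
  fixes a :: "'i \<Rightarrow> 'a::euclidean_space"
  assumes "finite I" and p: "\<And>i. i \<in> I \<Longrightarrow> a i \<bullet> p \<le> b i"
    and d: "\<And>i. i \<in> I \<Longrightarrow> a i \<bullet> p = b i \<Longrightarrow> a i \<bullet> d \<le> 0"
  shows "\<exists>t>0. \<forall>i\<in>I. a i \<bullet> (p + t *\<^sub>R d) \<le> b i"
proof -
  have "\<forall>\<^sub>F t in at_right 0. a i \<bullet> (p + t *\<^sub>R d) \<le> b i" if "i \<in> I" for i
  proof (cases "a i \<bullet> p = b i")
    case True
    show ?thesis
      using eventually_at_right_less[of "0::real"]
      by eventually_elim
        (use True d[OF that] in \<open>simp add: inner_add mult_nonneg_nonpos\<close>)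
  next
    case False
    have "((\<lambda>t. a i \<bullet> (p + t *\<^sub>R d)) \<longlongrightarrow> a i \<bullet> (p + 0 *\<^sub>R d)) (at_right 0)"
      by (intro tendsto_intros)
    moreover have "a i \<bullet> (p + 0 *\<^sub>R d) < b i" using False p[OF that] by simp
    ultimately have "\<forall>\<^sub>F t in at_right 0. a i \<bullet> (p + t *\<^sub>R d) < b i"
      by (rule order_tendstoD(2))
    then show ?thesis by eventually_elim simp
  qed
  then have "\<forall>\<^sub>F t in at_right 0. \<forall>i\<in>I. a i \<bullet> (p + t *\<^sub>R d) \<le> b i"
    using \<open>finite I\<close> by (simp add: eventually_ball_finite)
  then have "\<forall>\<^sub>F t in at_right 0. 0 < t \<and> (\<forall>i\<in>I. a i \<bullet> (p + t *\<^sub>R d) \<le> b i)"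
    using eventually_at_right_less[of "0::real"] by eventually_elim auto
  then show ?thesis
    using eventually_happens' trivial_limit_at_right_real by blast
qed

lemma convex_cone_hull_finite_coeffs:
  fixes J :: "'a::real_vector set"
  assumes "finite J" "z \<in> convex_cone hull J"
  obtains t where "\<And>a. a \<in> J \<Longrightarrow> 0 \<le> t a" "z = (\<Sum>a\<in>J. t a *\<^sub>R a)"
proof -
  define S where "S = {z. \<exists>t. (\<forall>a\<in>J. (0::real) \<le> t a) \<and> z = (\<Sum>a\<in>J. t a *\<^sub>R a)}"
  have "J \<subseteq> S"
  proof
    fix a assume "a \<in> J"
    have "a = (\<Sum>x\<in>J. (if x = a then 1 else 0) *\<^sub>R x)"
      using \<open>a \<in> J\<close> \<open>finite J\<close> by (simp add: if_distrib[of "\<lambda>c. c *\<^sub>R _"] cong: if_cong)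
    then show "a \<in> S" unfolding S_def
      by (intro CollectI exI[of _ "\<lambda>x. if x = a then 1 else 0"]) simp
  qed
  moreover have "convex_cone S"
    unfolding convex_cone_iff
  proof (intro conjI ballI allI impI)
    show "0 \<in> S" unfolding S_def by (intro CollectI exI[of _ "\<lambda>x. 0"]) simp
  next
    fix x y assume "x \<in> S" "y \<in> S"
    then obtain t u where "\<forall>a\<in>J. (0::real) \<le> t a" "x = (\<Sum>a\<in>J. t a *\<^sub>R a)"
      "\<forall>a\<in>J. (0::real) \<le> u a" "y = (\<Sum>a\<in>J. u a *\<^sub>R a)" unfolding S_def by blast
    then show "x + y \<in> S" unfolding S_def
      by (intro CollectI exI[of _ "\<lambda>a. t a + u a"]) (simp add: scaleR_left_distrib sum.distrib)
  next
    fix x and c :: real assume "x \<in> S" "0 \<le> c"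
    then obtain t where "\<forall>a\<in>J. (0::real) \<le> t a" "x = (\<Sum>a\<in>J. t a *\<^sub>R a)"
      unfolding S_def by blast
    then show "c *\<^sub>R x \<in> S" unfolding S_def using \<open>0 \<le> c\<close>
      by (intro CollectI exI[of _ "\<lambda>a. c * t a"]) (simp add: scaleR_sum_right)
  qed
  ultimately have "convex_cone hull J \<subseteq> S" by (rule hull_minimal)
  then show ?thesis using assms(2) that unfolding S_def by blast
qed

text \<open>The coefficients \<open>s\<close> may differ from \<open>t\<close>: dependent generators admit representations of a
  fixed point with arbitrarily large coefficients.\<close>

definition conic_coeff_bound :: "'a::real_normed_vector set \<Rightarrow> real \<Rightarrow> bool" where
  "conic_coeff_bound J M \<longleftrightarrow> 0 \<le> M \<and> (\<forall>t. (\<forall>a\<in>J. (0::real) \<le> t a) \<longrightarrow>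
     (\<exists>s. (\<forall>a\<in>J. 0 \<le> s a) \<and> (\<Sum>a\<in>J. s a *\<^sub>R a) = (\<Sum>a\<in>J. t a *\<^sub>R a) \<and>
          sum s J \<le> M * norm (\<Sum>a\<in>J. t a *\<^sub>R a)))"

lemma conic_coeff_boundE:
  assumes "conic_coeff_bound J M" "\<And>a. a \<in> J \<Longrightarrow> 0 \<le> t a" "z = (\<Sum>a\<in>J. t a *\<^sub>R a)"
  obtains s where "\<And>a. a \<in> J \<Longrightarrow> 0 \<le> s a" "(\<Sum>a\<in>J. s a *\<^sub>R a) = z" "sum s J \<le> M * norm z"
proof -
  have "\<forall>a\<in>J. 0 \<le> t a" using assms(2) by blast
  then show ?thesis using assms(1) that unfolding conic_coeff_bound_def assms(3) by blast
qed

text \<open>Quantitative conic Caratheodory theorem. For linearly independent generators the sum of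
  the coefficients is a linear functional of the point, hence bounded; for dependent generators a
  relation between them makes one generator superfluous at each point of the cone.\<close>

lemma conic_coeff_bound_exists:
  fixes J :: "'a::euclidean_space set"
  assumes "finite J"
  shows "\<exists>M. conic_coeff_bound J M"
  using assms
proof (induction J rule: finite_psubset_induct)
  case (psubset J)
  show ?case
  proof (cases "dependent J")
    case False
    then obtain h :: "'a \<Rightarrow> real" where h: "linear h" "\<forall>a\<in>J. h a = 1"
      using linear_independent_extend[of J "\<lambda>_. 1"] by auto
    obtain B where B: "B > 0" "\<And>z. norm (h z) \<le> B * norm z"
      using linear_bounded_pos[OF h(1)] by blast
    have "sum t J \<le> B * norm (\<Sum>a\<in>J. t a *\<^sub>R a)" for t
    proof -
      have "h (\<Sum>a\<in>J. t a *\<^sub>R a) = sum t J"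
        using h by (simp add: linear_sum linear_scale)
      then show ?thesis using B(2)[of "\<Sum>a\<in>J. t a *\<^sub>R a"] by simp
    qed
    then have "conic_coeff_bound J B" unfolding conic_coeff_bound_def using B(1) by fastforce
    then show ?thesis ..
  next
    case True
    then obtain u0 a0 where u0: "a0 \<in> J" "u0 a0 \<noteq> (0::real)" "(\<Sum>a\<in>J. u0 a *\<^sub>R a) = 0"
      using dependent_finite[OF psubset.hyps] by blast
    define u where "u a = sgn (u0 a0) * u0 a" for a
    have u: "u a0 > 0" "(\<Sum>a\<in>J. u a *\<^sub>R a) = 0"
      using u0 by (auto simp: u_def sgn_if scaleR_sum_right[symmetric] scaleR_scaleR[symmetric]
          sum_negf simp del: scaleR_scaleR)
    have "\<forall>i\<in>J. \<exists>M. conic_coeff_bound (J - {i}) M" using psubset.IH by blast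
    then obtain M where M: "\<And>i. i \<in> J \<Longrightarrow> conic_coeff_bound (J - {i}) (M i)" by metis
    then have M0: "\<And>i. i \<in> J \<Longrightarrow> 0 \<le> M i" unfolding conic_coeff_bound_def by blast
    have "conic_coeff_bound J (sum M J)"
      unfolding conic_coeff_bound_def
    proof (intro conjI allI impI)
      show "0 \<le> sum M J" using M0 by (simp add: sum_nonneg)
    next
      fix t assume t: "\<forall>a\<in>J. (0::real) \<le> t a"
      define z where "z = (\<Sum>a\<in>J. t a *\<^sub>R a)"
      define R where "R = (\<lambda>a. t a / u a) ` {a\<in>J. u a > 0}"
      have R: "finite R" "R \<noteq> {}"
        using psubset.hyps u(1) u0(1) by (auto simp: R_def)
      define th where "th = Min R"
      obtain i where i: "i \<in> J" "u i > 0" "th = t i / u i"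
        using Min_in[OF R] unfolding th_def R_def by auto
      have le: "th \<le> t a / u a" if "a \<in> J" "u a > 0" for a
        unfolding th_def using R(1) that by (intro Min_le) (auto simp: R_def)
      have "th \<ge> 0" using i t by simp
      define t' where "t' a = t a - th * u a" for a
      \<comment> \<open>\<open>th\<close> is the largest step along the relation \<open>u\<close> that keeps all coefficients nonnegative.\<close>
      have t'0: "t' a \<ge> 0" if "a \<in> J" for a
      proof (cases "u a > 0")
        case True
        then show ?thesis using le[OF that True] by (simp add: t'_def field_simps)
      next
        case False
        then have "th * u a \<le> 0" using \<open>th \<ge> 0\<close> by (simp add: mult_nonneg_nonpos)
        moreover have "t a \<ge> 0" using t that by blast
        ultimately show ?thesis unfolding t'_def by linarith
      qed
      have "t' i = 0" using i by (simp add: t'_def)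
      have "(\<Sum>a\<in>J. t' a *\<^sub>R a) = z - th *\<^sub>R (\<Sum>a\<in>J. u a *\<^sub>R a)"
        by (simp add: z_def t'_def scaleR_left_diff_distrib sum_subtractf scaleR_sum_right)
      then have "(\<Sum>a\<in>J. t' a *\<^sub>R a) = z" using u(2) by simp
      then have z: "z = (\<Sum>a\<in>J-{i}. t' a *\<^sub>R a)"
        using \<open>t' i = 0\<close> by (simp add: sum.remove[OF psubset.hyps i(1)])
      obtain s where s: "\<And>a. a \<in> J-{i} \<Longrightarrow> 0 \<le> s a" "(\<Sum>a\<in>J-{i}. s a *\<^sub>R a) = z"
        "sum s (J-{i}) \<le> M i * norm z"
        using conic_coeff_boundE[OF M[OF i(1)] t'0 z] by blast
      define s' where "s' = s(i := 0)"
      have "(\<Sum>a\<in>J. s' a *\<^sub>R a) = z"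
        unfolding s(2)[symmetric] sum.remove[OF psubset.hyps i(1)]
        by (auto simp: s'_def intro!: sum.cong)
      moreover have "sum s' J = sum s (J-{i})"
        unfolding sum.remove[OF psubset.hyps i(1)] by (auto simp: s'_def intro!: sum.cong)
      moreover have "M i \<le> sum M J"
        using M0 psubset.hyps i(1) by (intro member_le_sum) auto
      then have "M i * norm z \<le> sum M J * norm z" by (simp add: mult_right_mono)
      moreover have "\<forall>a\<in>J. 0 \<le> s' a" using s(1) by (simp add: s'_def)
      ultimately show "\<exists>s. (\<forall>a\<in>J. 0 \<le> s a) \<and> (\<Sum>a\<in>J. s a *\<^sub>R a) = (\<Sum>a\<in>J. t a *\<^sub>R a) \<and>
                sum s J \<le> sum M J * norm (\<Sum>a\<in>J. t a *\<^sub>R a)"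
        using s(3) unfolding z_def[symmetric] by (intro exI[of _ s']) auto
    qed
    then show ?thesis ..
  qed
qed

text \<open>A point outside the closed cone is separated from it by its residual \<open>s - p\<close> to the projection
  \<open>p\<close>, which is orthogonal to \<open>p\<close> because the cone contains \<open>0\<close> and \<open>2 p\<close>.\<close>

lemma Farkas:
  fixes J :: "'a::euclidean_space set"
  assumes "finite J" and s: "\<And>d. (\<And>a. a \<in> J \<Longrightarrow> a \<bullet> d \<le> 0) \<Longrightarrow> s \<bullet> d \<le> 0"
  shows "s \<in> convex_cone hull J"
proof (rule ccontr)
  let ?K = "convex_cone hull J"
  assume "s \<notin> ?K"
  define p where "p = closest_point ?K s"
  have K: "convex ?K" "closed ?K" "?K \<noteq> {}"
    using closed_convex_cone_hull[OF assms(1)]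
    by (auto simp: convex_convex_cone_hull convex_cone_hull_nonempty)
  have p: "p \<in> ?K" unfolding p_def using K by (simp add: closest_point_in_set)
  have dot: "(s - p) \<bullet> (x - p) \<le> 0" if "x \<in> ?K" for x
    unfolding p_def using closest_point_dot[OF K(1,2) that] .
  have orth: "(s - p) \<bullet> p = 0"
    using dot[OF convex_cone_hull_contains_0]
      dot[OF convex_cone_hull_mul[OF p, of 2]] by (simp add: scaleR_2 inner_diff)
  have "a \<bullet> (s - p) \<le> 0" if "a \<in> J" for a
  proof -
    have "(s - p) \<bullet> (a - p) \<le> 0" using dot that by (simp add: hull_inc)
    then have "(s - p) \<bullet> a \<le> 0" using orth by (simp only: inner_diff_right diff_0_right)
    then show ?thesis by (simp only: inner_commute)
  qed
  then have "s \<bullet> (s - p) \<le> 0" by (rule s)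
  moreover have "(s - p) \<bullet> (s - p) = s \<bullet> (s - p) - (s - p) \<bullet> p"
    using inner_diff_left[of s p "s - p"] inner_commute[of p "s - p"] by linarith
  ultimately have "(s - p) \<bullet> (s - p) \<le> 0" using orth by linarith
  then have "s = p" by (metis eq_iff_diff_eq_0 inner_gt_zero_iff not_less)
  then show False using p \<open>s \<notin> ?K\<close> by simp
qed

text \<open>Hoffman's lemma. The residual of the projection onto the polyhedron is a conic combination
  of the active constraint normals with coefficients controlled by its length, so its squared
  length is at most its length times the constraint violation. Only finitely many sets of normals
  occur, which makes the constant uniform.\<close>

lemma Hoffman:
  fixes a :: "'i \<Rightarrow> 'a::euclidean_space"
  assumes "finite I" and ne: "{x. \<forall>i\<in>I. a i \<bullet> x \<le> b i} \<noteq> {}"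
  shows "\<exists>M\<ge>0. \<forall>x \<delta>. (\<forall>i\<in>I. a i \<bullet> x \<le> b i + \<delta>) \<longrightarrow> 0 \<le> \<delta> \<longrightarrow>
           infdist x {x. \<forall>i\<in>I. a i \<bullet> x \<le> b i} \<le> M * \<delta>"
proof -
  let ?P = "{x. \<forall>i\<in>I. a i \<bullet> x \<le> b i}"
  have P: "closed ?P" "convex ?P"
    using polyhedron_inequalities[OF assms(1), of a b]
    by (auto simp only: polyhedron_imp_closed polyhedron_imp_convex)
  obtain M where M: "\<And>J::'a set. finite J \<Longrightarrow> conic_coeff_bound J (M J)"
    using conic_coeff_bound_exists by metis
  then have M0: "\<And>J. finite J \<Longrightarrow> 0 \<le> M J" unfolding conic_coeff_bound_def by blast
  define N where "N = sum M (Pow (a ` I))"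
  have fin: "finite J" if "J \<in> Pow (a ` I)" for J
    using that assms(1) by (meson PowD finite_imageI finite_subset)
  have "N \<ge> 0" unfolding N_def by (rule sum_nonneg) (use M0 fin in blast)
  moreover have "infdist x ?P \<le> N * \<delta>"
    if x: "\<forall>i\<in>I. a i \<bullet> x \<le> b i + \<delta>" and "0 \<le> \<delta>" for x \<delta>
  proof -
    define p where "p = closest_point ?P x"
    have p: "p \<in> ?P" unfolding p_def using P ne by (simp add: closest_point_in_set del: mem_Collect_eq)
    define J where "J = a ` {i\<in>I. a i \<bullet> p = b i}"
    have J: "J \<in> Pow (a ` I)" unfolding J_def by blast
    have fJ: "finite J" using fin[OF J] .
    have "x - p \<in> convex_cone hull J"
    proof (rule Farkas[OF fJ])
      fix d assume d: "\<And>c. c \<in> J \<Longrightarrow> c \<bullet> d \<le> 0"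
      have "\<exists>t>0. \<forall>i\<in>I. a i \<bullet> (p + t *\<^sub>R d) \<le> b i"
        by (rule polyhedron_feasible_direction[OF assms(1)]) (use p d in \<open>auto simp: J_def\<close>)
      then obtain t where t: "t > 0" "p + t *\<^sub>R d \<in> ?P" by blast
      have "(x - p) \<bullet> (p + t *\<^sub>R d - p) \<le> 0"
        using closest_point_dot[OF P(2,1) t(2), of x] unfolding p_def .
      then show "(x - p) \<bullet> d \<le> 0" using t(1) by (simp add: mult_le_0_iff)
    qed
    then obtain t where t: "\<And>c. c \<in> J \<Longrightarrow> 0 \<le> t c" "x - p = (\<Sum>c\<in>J. t c *\<^sub>R c)"
      using convex_cone_hull_finite_coeffs[OF fJ] by blast
    obtain s where s: "\<And>c. c \<in> J \<Longrightarrow> 0 \<le> s c" "(\<Sum>c\<in>J. s c *\<^sub>R c) = x - p"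
      "sum s J \<le> M J * norm (x - p)"
      using conic_coeff_boundE[OF M[OF fJ] t] by blast
    have "(norm (x - p))\<^sup>2 = (\<Sum>c\<in>J. s c *\<^sub>R c) \<bullet> (x - p)"
      unfolding s(2) by (simp add: power2_norm_eq_inner)
    also have "\<dots> = (\<Sum>c\<in>J. s c * (c \<bullet> (x - p)))" by (simp add: inner_sum_left)
    also have "\<dots> \<le> (\<Sum>c\<in>J. s c * \<delta>)"
    proof (rule sum_mono)
      fix c assume c: "c \<in> J"
      then obtain i where "i \<in> I" "c = a i" "a i \<bullet> p = b i" unfolding J_def by blast
      then have "c \<bullet> (x - p) \<le> \<delta>" using x by (auto simp: inner_diff_right)
      then show "s c * (c \<bullet> (x - p)) \<le> s c * \<delta>" using s(1)[OF c] by (rule mult_left_mono)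
    qed
    also have "\<dots> = sum s J * \<delta>" by (simp add: sum_distrib_right)
    also have "\<dots> \<le> M J * norm (x - p) * \<delta>" using s(3) \<open>0 \<le> \<delta>\<close> by (rule mult_right_mono)
    also have "\<dots> \<le> N * norm (x - p) * \<delta>"
    proof -
      have "M J \<le> N" unfolding N_def
        using J M0 fin assms(1) by (intro member_le_sum) auto
      then show ?thesis using \<open>0 \<le> \<delta>\<close> by (simp add: mult_right_mono)
    qed
    finally have "norm (x - p) * norm (x - p) \<le> (N * \<delta>) * norm (x - p)"
      by (simp add: power2_eq_square mult_ac)
    moreover have "N * \<delta> \<ge> 0" using \<open>N \<ge> 0\<close> \<open>0 \<le> \<delta>\<close> by simp
    ultimately have "norm (x - p) \<le> N * \<delta>"
      by (cases "norm (x - p) = 0") (auto simp: mult_le_cancel_right)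
    then show ?thesis using infdist_le[OF p, of x] by (simp add: dist_norm)
  qed
  ultimately show ?thesis by blast
qed

lemma Hoffman_affine_vimage:
  fixes T :: "'a::euclidean_space \<Rightarrow> 'b::euclidean_space"
  assumes "linear T" "polyhedron Q" and ne: "{x. T x + c \<in> Q} \<noteq> {}"
  shows "\<exists>M\<ge>0. \<forall>x. \<forall>q\<in>Q. infdist x {x. T x + c \<in> Q} \<le> M * norm (T x + c - q)"
proof -
  obtain F where F: "finite F" "Q = {x. \<forall>i\<in>F. fst i \<bullet> x \<le> snd i}"
    using polyhedron_eq_inequalities[OF assms(2)] .
  let ?a = "\<lambda>i. adjoint T (fst i)" and ?b = "\<lambda>i. snd i - fst i \<bullet> c"
  note eq = affine_vimage_eq_inequalities[OF assms(1), of c F, folded F(2)]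
  let ?bounded = "\<lambda>M. M \<ge> 0 \<and> (\<forall>x \<delta>. (\<forall>i\<in>F. ?a i \<bullet> x \<le> ?b i + \<delta>) \<longrightarrow> 0 \<le> \<delta> \<longrightarrow>
      infdist x {x. T x + c \<in> Q} \<le> M * \<delta>)"
  have "\<exists>M. ?bounded M" using Hoffman[OF F(1) ne[unfolded eq]] unfolding eq .
  then obtain M where M: "?bounded M" ..
  define B where "B = (\<Sum>i\<in>F. norm (fst i))"
  have "B \<ge> 0" unfolding B_def by (simp add: sum_nonneg)
  have "infdist x {x. T x + c \<in> Q} \<le> M * B * norm (T x + c - q)" if "q \<in> Q" for x q
  proof -
    have "?a i \<bullet> x \<le> ?b i + B * norm (T x + c - q)" if i: "i \<in> F" for i
    proof -
      have "?a i \<bullet> x = fst i \<bullet> (T x + c - q) + fst i \<bullet> q - fst i \<bullet> c"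
        by (simp add: adjoint_inner_left[OF assms(1)] inner_add_right inner_diff_right)
      moreover have "fst i \<bullet> q \<le> snd i" using \<open>q \<in> Q\<close> i F(2) by auto
      moreover have "fst i \<bullet> (T x + c - q) \<le> norm (fst i) * norm (T x + c - q)"
        by (rule norm_cauchy_schwarz)
      moreover have "norm (fst i) \<le> B" unfolding B_def
        using F(1) i by (intro member_le_sum) auto
      then have "norm (fst i) * norm (T x + c - q) \<le> B * norm (T x + c - q)"
        by (simp add: mult_right_mono)
      ultimately show ?thesis by linarith
    qed
    then have "\<forall>i\<in>F. ?a i \<bullet> x \<le> ?b i + B * norm (T x + c - q)" ..
    moreover have "0 \<le> B * norm (T x + c - q)" using \<open>B \<ge> 0\<close> by simp
    ultimately have "infdist x {x. T x + c \<in> Q} \<le> M * (B * norm (T x + c - q))"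
      using M[THEN conjunct2, rule_format] by blast
    then show ?thesis by (simp only: mult.assoc)
  qed
  moreover have "0 \<le> M * B" using M \<open>B \<ge> 0\<close> by simp
  ultimately show ?thesis by blast
qed

section \<open>Normal cones of polyhedra and polyhedral functions\<close>

lemma mem_normal_cone:
  "s \<in> normal_cone P p \<longleftrightarrow> p \<in> P \<and> (\<forall>z\<in>P. s \<bullet> (z - p) \<le> 0)"
  by (auto simp: normal_cone_def subdifferential_def delta_fun_def zero_ereal_def)

text \<open>Near \<open>p\<close> only constraints active at \<open>p\<close> can be active, so every direction from \<open>p\<close> into
  the polyhedron is also feasible at the nearby points.\<close>

lemma normal_cone_subset_near:
  fixes P :: "'a::euclidean_space set"
  assumes "polyhedron P" "p \<in> P"
  shows "\<exists>r>0. \<forall>q. dist q p < r \<longrightarrow> normal_cone P q \<subseteq> normal_cone P p"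
proof -
  obtain F where F: "finite F" "P = {x. \<forall>i\<in>F. fst i \<bullet> x \<le> snd i}"
    using polyhedron_eq_inequalities[OF assms(1)] .
  have "\<forall>\<^sub>F q in nhds p. fst i \<bullet> p < snd i \<longrightarrow> fst i \<bullet> q < snd i" for i :: "'a \<times> real"
  proof (cases "fst i \<bullet> p < snd i")
    case True
    have "((\<lambda>q. fst i \<bullet> q) \<longlongrightarrow> fst i \<bullet> p) (nhds p)"
      by (intro tendsto_intros filterlim_ident)
    from order_tendstoD(2)[OF this True] show ?thesis by eventually_elim simp
  qed simp
  then have "\<forall>\<^sub>F q in nhds p. \<forall>i\<in>F. fst i \<bullet> p < snd i \<longrightarrow> fst i \<bullet> q < snd i"
    by (intro eventually_ball_finite[OF F(1)]) blast
  then obtain r where r: "r > 0"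
    "\<And>q i. dist q p < r \<Longrightarrow> i \<in> F \<Longrightarrow> fst i \<bullet> p < snd i \<Longrightarrow> fst i \<bullet> q < snd i"
    unfolding eventually_nhds_metric by blast
  have "s \<in> normal_cone P p" if q: "dist q p < r" and s: "s \<in> normal_cone P q" for q s
  proof -
    have "s \<bullet> (x - p) \<le> 0" if x: "x \<in> P" for x
    proof -
      have "\<exists>t>0. \<forall>i\<in>F. fst i \<bullet> (q + t *\<^sub>R (x - p)) \<le> snd i"
      proof (rule polyhedron_feasible_direction[OF F(1)])
        fix i assume i: "i \<in> F"
        show "fst i \<bullet> q \<le> snd i" using s i unfolding mem_normal_cone F(2) by auto
        assume "fst i \<bullet> q = snd i"
        then have "\<not> fst i \<bullet> p < snd i" using r(2)[OF q i] by auto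
        moreover have "fst i \<bullet> x \<le> snd i" using x i unfolding F(2) by auto
        ultimately show "fst i \<bullet> (x - p) \<le> 0" by (simp add: inner_diff_right)
      qed
      then obtain t where t: "t > 0" "q + t *\<^sub>R (x - p) \<in> P" unfolding F(2) by auto
      then have "s \<bullet> (q + t *\<^sub>R (x - p) - q) \<le> 0" using s unfolding mem_normal_cone by blast
      then show ?thesis using t(1) by (simp add: mult_le_0_iff)
    qed
    then show ?thesis using assms(2) unfolding mem_normal_cone by blast
  qed
  then show ?thesis using r(1) by blast
qed

text \<open>By Farkas' lemma the normal cone is generated by the active constraint normals.\<close>

lemma polyhedron_normal_cone:
  fixes P :: "'a::euclidean_space set"
  assumes "polyhedron P" "p \<in> P"
  shows "polyhedron (normal_cone P p)"
proof -
  obtain F where F: "finite F" "P = {x. \<forall>i\<in>F. fst i \<bullet> x \<le> snd i}"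
    using polyhedron_eq_inequalities[OF assms(1)] .
  define J where "J = fst ` {i\<in>F. fst i \<bullet> p = snd i}"
  have fJ: "finite J" using F(1) by (simp add: J_def)
  have pF: "fst i \<bullet> p \<le> snd i" if "i \<in> F" for i using assms(2) that unfolding F(2) by auto
  have "normal_cone P p = convex_cone hull J"
  proof
    show "normal_cone P p \<subseteq> convex_cone hull J"
    proof
      fix s assume s: "s \<in> normal_cone P p"
      show "s \<in> convex_cone hull J"
      proof (rule Farkas[OF fJ])
        fix d assume d: "\<And>a. a \<in> J \<Longrightarrow> a \<bullet> d \<le> 0"
        have "\<exists>t>0. \<forall>i\<in>F. fst i \<bullet> (p + t *\<^sub>R d) \<le> snd i"
          by (rule polyhedron_feasible_direction[OF F(1) pF]) (use d in \<open>auto simp: J_def\<close>)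
        then obtain t where t: "t > 0" "p + t *\<^sub>R d \<in> P" unfolding F(2) by auto
        then have "s \<bullet> (p + t *\<^sub>R d - p) \<le> 0" using s unfolding mem_normal_cone by blast
        then show "s \<bullet> d \<le> 0" using t(1) by (simp add: mult_le_0_iff)
      qed
    qed
    show "convex_cone hull J \<subseteq> normal_cone P p"
    proof (rule hull_minimal)
      show "J \<subseteq> normal_cone P p"
      proof
        fix a assume "a \<in> J"
        then obtain i where "i \<in> F" "a = fst i" "a \<bullet> p = snd i" unfolding J_def by blast
        then have "a \<bullet> (z - p) \<le> 0" if "z \<in> P" for z
          using that unfolding F(2) by (auto simp: inner_diff_right)
        then show "a \<in> normal_cone P p" using assms(2) unfolding mem_normal_cone by blast
      qed
      show "convex_cone (normal_cone P p)"
        unfolding convex_cone_iff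
        by (auto simp: mem_normal_cone assms(2) inner_add_left add_nonpos_nonpos mult_nonneg_nonpos)
    qed
  qed
  then show ?thesis using polyhedron_convex_cone_hull[OF fJ] by simp
qed

text \<open>Only the active constraints restrict the directions, so the cone is given by finitely many
  inequalities; for general closed convex sets it need not be closed.\<close>

lemma closed_feasible_directions:
  fixes P :: "'a::euclidean_space set"
  assumes "polyhedron P" "p \<in> P"
  shows "closed {d. \<exists>t>0. p + t *\<^sub>R d \<in> P}"
proof -
  obtain F where F: "finite F" "P = {x. \<forall>i\<in>F. fst i \<bullet> x \<le> snd i}"
    using polyhedron_eq_inequalities[OF assms(1)] .
  have pF: "fst i \<bullet> p \<le> snd i" if "i \<in> F" for i using assms(2) that unfolding F(2) by auto
  have eq: "{d. \<exists>t>0. p + t *\<^sub>R d \<in> P} = {d. \<forall>i\<in>{i\<in>F. fst i \<bullet> p = snd i}. fst i \<bullet> d \<le> 0}"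
  proof (intro equalityI subsetI CollectI ballI)
    fix d i assume "d \<in> {d. \<exists>t>0. p + t *\<^sub>R d \<in> P}" and i: "i \<in> {i\<in>F. fst i \<bullet> p = snd i}"
    then obtain t where t: "t > 0" "p + t *\<^sub>R d \<in> P" by blast
    then have "fst i \<bullet> (p + t *\<^sub>R d) \<le> snd i" using i unfolding F(2) by auto
    then show "fst i \<bullet> d \<le> 0" using i t(1) by (simp add: inner_add_right mult_le_0_iff)
  next
    fix d assume d: "d \<in> {d. \<forall>i\<in>{i\<in>F. fst i \<bullet> p = snd i}. fst i \<bullet> d \<le> 0}"
    have "\<exists>t>0. \<forall>i\<in>F. fst i \<bullet> (p + t *\<^sub>R d) \<le> snd i"
      by (rule polyhedron_feasible_direction[OF F(1) pF]) (use d in auto)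
    then show "\<exists>t>0. p + t *\<^sub>R d \<in> P" unfolding F(2) by auto
  qed
  have "finite {i\<in>F. fst i \<bullet> p = snd i}" using F(1) by simp
  from polyhedron_imp_closed[OF polyhedron_inequalities[OF this, of fst "\<lambda>_. 0"]]
  show ?thesis by (simp only: eq)
qed

lemma subdifferential_finite: "s \<in> subdifferential g y \<Longrightarrow> \<exists>c. g y = ereal c"
  unfolding subdifferential_def by (cases "g y") auto

lemma subdifferentialD:
  assumes "s \<in> subdifferential g y" "g y = ereal c" "g z \<le> ereal d"
  shows "c + s \<bullet> (z - y) \<le> d"
proof -
  have "ereal (c + s \<bullet> (z - y)) \<le> g z" using assms unfolding subdifferential_def by auto
  then show ?thesis using assms(3) by (metis ereal_less_eq(3) order_trans)
qed

lemma subdifferential_monotone: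
  assumes "s \<in> subdifferential g y" "t \<in> subdifferential g z"
  shows "0 \<le> (s - t) \<bullet> (y - z)"
proof -
  obtain c d where c: "g y = ereal c" "g z = ereal d"
    using assms subdifferential_finite by metis
  have "c + s \<bullet> (z - y) \<le> d" "d + t \<bullet> (y - z) \<le> c"
    using subdifferentialD assms c by (metis order_refl)+
  then show ?thesis by (simp add: inner_diff_left inner_diff_right)
qed

lemma subdifferential_iff_normal_cone:
  assumes "g y = ereal c"
  shows "s \<in> subdifferential g y \<longleftrightarrow> (s, -1) \<in> normal_cone (ereal_epigraph g) (y, c)"
proof
  assume s: "s \<in> subdifferential g y"
  show "(s, -1) \<in> normal_cone (ereal_epigraph g) (y, c)"
    using subdifferentialD[OF s assms] assms
    by (force simp: mem_normal_cone ereal_epigraph_def)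
next
  assume n: "(s, -1) \<in> normal_cone (ereal_epigraph g) (y, c)"
  have le: "c + s \<bullet> (z - y) \<le> d" if "g z \<le> ereal d" for z d
  proof -
    have "(z, d) \<in> ereal_epigraph g" using that by (simp add: ereal_epigraph_def)
    then have "(s, -1) \<bullet> ((z, d) - (y, c)) \<le> 0" using n unfolding mem_normal_cone by blast
    then show ?thesis by simp
  qed
  have "ereal (c + s \<bullet> (z - y)) \<le> g z" for z
  proof (cases "g z")
    case (real d)
    then show ?thesis using le[of z d] by simp
  next
    case MInf
    then have "c + s \<bullet> (z - y) \<le> c + s \<bullet> (z - y) - 1" by (intro le) simp
    then show ?thesis by simp
  qed simp
  then show "s \<in> subdifferential g y" using assms by (simp add: subdifferential_def)
qed

lemma polyhedron_subdifferential:
  fixes g :: "'a::euclidean_space \<Rightarrow> ereal"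
  assumes "polyhedral_convex_fun g" "g y = ereal c"
  shows "polyhedron (subdifferential g y)"
proof -
  have "(y, c) \<in> ereal_epigraph g" using assms(2) by (simp add: ereal_epigraph_def)
  moreover have "polyhedron (ereal_epigraph g)"
    using assms(1) by (simp add: polyhedral_convex_fun_def)
  ultimately have N: "polyhedron (normal_cone (ereal_epigraph g) (y, c))"
    by (intro polyhedron_normal_cone)
  \<comment> \<open>The subdifferential is the slice of the normal cone at height \<open>- 1\<close>.\<close>
  have "linear (\<lambda>s::'a. (s, 0::real))" by (simp add: linear_iff)
  from polyhedron_affine_vimage[OF this N, of "(0, -1)"] show ?thesis
    by (simp add: subdifferential_iff_normal_cone[where g = g and y = y, OF assms(2), symmetric])
qed

text \<open>The subgradient inequality bounds the increments of \<open>g\<close> from below and convexity carries the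
  upper bound at \<open>\<tau>\<close> over to shorter steps, so \<open>g\<close> is affine along the segment.\<close>

lemma mem_T_cone_of_decrease:
  assumes conv: "convex (ereal_epigraph g)" and l: "l \<in> subdifferential g y" and c: "g y = ereal c"
    and "0 < \<tau>" and le: "g (y + \<tau> *\<^sub>R w) \<le> ereal (c + \<tau> * (l \<bullet> w))"
  shows "w \<in> T_cone g y l"
proof -
  have eq: "g (y + t *\<^sub>R w) = ereal (c + t * (l \<bullet> w))" if t: "0 < t" "t \<le> \<tau>" for t
  proof (rule antisym)
    have "(y, c) \<in> ereal_epigraph g" "(y + \<tau> *\<^sub>R w, c + \<tau> * (l \<bullet> w)) \<in> ereal_epigraph g"
      using c le by (auto simp: ereal_epigraph_def)
    then have "(1 - t / \<tau>) *\<^sub>R (y, c) + (t / \<tau>) *\<^sub>R (y + \<tau> *\<^sub>R w, c + \<tau> * (l \<bullet> w)) \<in> ereal_epigraph g"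
      using t by (intro convexD[OF conv]) auto
    moreover have "(1 - t / \<tau>) *\<^sub>R (y, c) + (t / \<tau>) *\<^sub>R (y + \<tau> *\<^sub>R w, c + \<tau> * (l \<bullet> w))
        = (y + t *\<^sub>R w, c + t * (l \<bullet> w))"
      using \<open>0 < \<tau>\<close> by (simp add: algebra_simps)
    ultimately show "g (y + t *\<^sub>R w) \<le> ereal (c + t * (l \<bullet> w))"
      by (simp add: ereal_epigraph_def)
    have "g y + ereal (l \<bullet> (y + t *\<^sub>R w - y)) \<le> g (y + t *\<^sub>R w)"
      using l unfolding subdifferential_def by blast
    then show "ereal (c + t * (l \<bullet> w)) \<le> g (y + t *\<^sub>R w)" using c by simp
  qed
  have "\<forall>\<^sub>F t in at_right 0. (g (y + t *\<^sub>R w) - g y) / ereal t = ereal (l \<bullet> w)"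
    using eventually_at_right_less[of "0::real"] eventually_at_right_real[OF \<open>0 < \<tau>\<close>]
  proof eventually_elim
    case (elim t)
    then have "g (y + t *\<^sub>R w) = ereal (c + t * (l \<bullet> w))" by (intro eq) auto
    then show ?case using c elim by simp
  qed
  then have "((\<lambda>t. (g (y + t *\<^sub>R w) - g y) / ereal t) \<longlongrightarrow> ereal (l \<bullet> w)) (at_right 0)"
    by (rule tendsto_eventually)
  then have "Lim (at_right 0) (\<lambda>t. (g (y + t *\<^sub>R w) - g y) / ereal t) = ereal (l \<bullet> w)"
    by (rule tendsto_Lim[OF trivial_limit_at_right_real])
  then show ?thesis by (simp add: T_cone_def dir_deriv_def)
qed

text \<open>Local form of the graph of \<open>\<partial>g\<close> for polyhedral \<open>g\<close>. Applied to the epigraph, the local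
  inclusion of normal cones gives \<open>l \<in> \<partial>g(ybar)\<close>; then \<open>y - ybar\<close> is normal to the polyhedron
  \<open>\<partial>g(ybar)\<close> at \<open>l\<close>, and a second application moves it to the normal cone at \<open>lbar\<close>, where \<open>g\<close>
  is linear with slope \<open>lbar\<close>. The cone \<open>K\<close> consists of the directions along which this happens;
  it is closed because \<open>g\<close> is polyhedral.\<close>

lemma subdifferential_graph_near:
  fixes g :: "'a::euclidean_space \<Rightarrow> ereal"
  assumes g: "polyhedral_convex_fun g" and lbar: "lbar \<in> subdifferential g ybar"
  obtains K r where "closed K" "0 \<in> K" "\<And>w s. w \<in> K \<Longrightarrow> 0 < s \<Longrightarrow> s *\<^sub>R w \<in> K"
    "K \<subseteq> T_cone g ybar lbar" "r > 0"
    "\<And>y l. l \<in> subdifferential g y \<Longrightarrow> norm (y - ybar) < r \<Longrightarrow> norm (l - lbar) < r \<Longrightarrow>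
        l \<in> subdifferential g ybar \<and> y - ybar \<in> K"
proof -
  let ?E = "ereal_epigraph g"
  have E: "polyhedron ?E" "convex ?E" using g by (auto simp: polyhedral_convex_fun_def)
  obtain c where c: "g ybar = ereal c" using subdifferential_finite[OF lbar] by blast
  have cE: "(ybar, c) \<in> ?E" using c by (simp add: ereal_epigraph_def)
  define K where "K = {w. \<exists>t>0. (ybar, c) + t *\<^sub>R (w, lbar \<bullet> w) \<in> ?E}"
  have "closed ((\<lambda>w. (w, lbar \<bullet> w)) -` {d. \<exists>t>0. (ybar, c) + t *\<^sub>R d \<in> ?E})"
    by (intro continuous_closed_vimage closed_feasible_directions E cE continuous_intros)
  then have Kc: "closed K" by (simp add: K_def vimage_def)
  have K0: "0 \<in> K" unfolding K_def using cE by (auto simp: zero_prod_def[symmetric] intro: exI[of _ 1])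
  have Ks: "s *\<^sub>R w \<in> K" if w: "w \<in> K" and "0 < s" for w s
  proof -
    obtain t where "t > 0" "(ybar, c) + t *\<^sub>R (w, lbar \<bullet> w) \<in> ?E" using w unfolding K_def by blast
    then show ?thesis unfolding K_def using \<open>0 < s\<close>
      by (intro CollectI exI[of _ "t / s"]) auto
  qed
  have KT: "K \<subseteq> T_cone g ybar lbar"
    using mem_T_cone_of_decrease[OF E(2) lbar c] by (auto simp: K_def ereal_epigraph_def)
  obtain r1 where r1: "r1 > 0" "\<And>q. dist q (ybar, c) < r1 \<Longrightarrow> normal_cone ?E q \<subseteq> normal_cone ?E (ybar, c)"
    using normal_cone_subset_near[OF E(1) cE] by blast
  obtain r2 where r2: "r2 > 0" "\<And>l. dist l lbar < r2 \<Longrightarrow>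
      normal_cone (subdifferential g ybar) l \<subseteq> normal_cone (subdifferential g ybar) lbar"
    using normal_cone_subset_near[OF polyhedron_subdifferential[OF g c] lbar] by blast
  \<comment> \<open>The two subgradient inequalities make \<open>g\<close> Lipschitz between \<open>ybar\<close> and the points considered;
    \<open>B\<close> bounds the resulting distance of the points of the epigraph.\<close>
  define B where "B = 1 + norm lbar + r2"
  have "B > 0" using r2(1) by (simp add: B_def add_pos_nonneg)
  have near: "l \<in> subdifferential g ybar \<and> y - ybar \<in> K"
    if l: "l \<in> subdifferential g y" and y: "norm (y - ybar) < min r2 (r1 / B)"
      and ll: "norm (l - lbar) < min r2 (r1 / B)" for y l
  proof -
    obtain b where b: "g y = ereal b" using subdifferential_finite[OF l] by blast
    have 1: "b - c \<le> l \<bullet> (y - ybar)"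
      using subdifferentialD[OF l b, of ybar c] c by (simp add: inner_diff_right)
    have sub: "s \<bullet> (y - ybar) \<le> b - c" if "s \<in> subdifferential g ybar" for s
      using subdifferentialD[OF that c, of y b] b by (simp add: inner_diff_right)
    have "norm l \<le> norm lbar + r2"
      using norm_triangle_ineq2[of l lbar] ll by linarith
    then have "norm l * norm (y - ybar) \<le> (norm lbar + r2) * norm (y - ybar)"
      by (rule mult_right_mono) simp
    moreover have "norm lbar * norm (y - ybar) \<le> (norm lbar + r2) * norm (y - ybar)"
      using r2(1) by (intro mult_right_mono) auto
    moreover have "\<bar>l \<bullet> (y - ybar)\<bar> \<le> norm l * norm (y - ybar)"
      "\<bar>lbar \<bullet> (y - ybar)\<bar> \<le> norm lbar * norm (y - ybar)"
      by (rule Cauchy_Schwarz_ineq2)+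
    ultimately have "\<bar>b - c\<bar> \<le> (norm lbar + r2) * norm (y - ybar)"
      using 1 sub[OF lbar] by linarith
    moreover have "dist (y, b) (ybar, c) \<le> norm (y - ybar) + \<bar>b - c\<bar>"
      unfolding dist_Pair_Pair by (rule order_trans[OF sqrt_sum_squares_le_sum]) (auto simp: dist_norm)
    ultimately have "dist (y, b) (ybar, c) \<le> B * norm (y - ybar)"
      by (simp add: B_def distrib_right)
    also have "\<dots> < r1" using y \<open>B > 0\<close> by (simp add: pos_less_divide_eq mult.commute)
    finally have "(l, -1) \<in> normal_cone ?E (ybar, c)"
      using r1(2) l subdifferential_iff_normal_cone[of g y b] b by blast
    then have lb: "l \<in> subdifferential g ybar" using subdifferential_iff_normal_cone[of g ybar c] c by blast
    have "y - ybar \<in> normal_cone (subdifferential g ybar) l"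
      unfolding mem_normal_cone
    proof (intro conjI ballI)
      fix s assume "s \<in> subdifferential g ybar"
      from sub[OF this] 1 have "(s - l) \<bullet> (y - ybar) \<le> 0" by (simp add: inner_diff_left)
      then show "(y - ybar) \<bullet> (s - l) \<le> 0" by (simp only: inner_commute)
    qed (rule lb)
    moreover have "dist l lbar < r2" using ll by (simp add: dist_norm)
    ultimately have "y - ybar \<in> normal_cone (subdifferential g ybar) lbar" using r2(2) by blast
    then have "(y - ybar) \<bullet> (l - lbar) \<le> 0" using lb unfolding mem_normal_cone by blast
    then have "(l - lbar) \<bullet> (y - ybar) \<le> 0" by (simp only: inner_commute)
    then have "b \<le> c + lbar \<bullet> (y - ybar)" using 1 unfolding inner_diff_left by linarith
    then have "(ybar, c) + 1 *\<^sub>R (y - ybar, lbar \<bullet> (y - ybar)) \<in> ?E"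
      using b by (simp add: ereal_epigraph_def)
    then have "y - ybar \<in> K" unfolding K_def using zero_less_one by blast
    with lb show ?thesis by blast
  qed
  have "min r2 (r1 / B) > 0" using r1(1) r2(1) \<open>B > 0\<close> by simp
  from that[OF Kc K0 Ks KT this near] show ?thesis .
qed

section \<open>Consequences of the second-order condition\<close>

text \<open>A Debreu--Finsler type lemma with the preimage of a closed cone in place of the kernel of \<open>A\<close>.
  For normalised pairs violating the bound with growing penalties, \<open>A *v v - w\<close> is forced to
  zero, so a limit direction is mapped into the cone but has nonpositive curvature.\<close>

lemma penalized_form_coercive:
  fixes A :: "real^'n^'m" and H :: "real^'n^'n"
  assumes V: "subspace V" and K: "closed K" "\<And>w s. w \<in> K \<Longrightarrow> 0 < s \<Longrightarrow> s *\<^sub>R w \<in> K"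
    and pos: "\<And>v. v \<in> V \<Longrightarrow> v \<noteq> 0 \<Longrightarrow> A *v v \<in> K \<Longrightarrow> 0 < v \<bullet> (H *v v)"
  shows "\<exists>b c. 0 < b \<and> 0 < c \<and> (\<forall>v w. v \<in> V \<longrightarrow> w \<in> K \<longrightarrow>
      c * (norm v)\<^sup>2 \<le> v \<bullet> (H *v v) + b * (norm (A *v v - w))\<^sup>2)"
proof (rule ccontr)
  assume neg: "\<not> ?thesis"
  have "\<exists>u w. u \<in> V \<and> norm u = 1 \<and> w \<in> K \<and>
      u \<bullet> (H *v u) + real (Suc n) * (norm (A *v u - w))\<^sup>2 < inverse (real (Suc n))" for n
  proof -
    have "0 < real (Suc n)" "0 < inverse (real (Suc n))" by auto
    then obtain v w where vw: "v \<in> V" "w \<in> K"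
      "v \<bullet> (H *v v) + real (Suc n) * (norm (A *v v - w))\<^sup>2 < inverse (real (Suc n)) * (norm v)\<^sup>2"
      using neg by (metis not_le)
    have "v \<noteq> 0"
    proof
      assume "v = 0"
      then have "real (Suc n) * (norm w)\<^sup>2 < 0" using vw(3) by simp
      moreover have "0 \<le> real (Suc n) * (norm w)\<^sup>2" by simp
      ultimately show False by linarith
    qed
    define s where "s = inverse (norm v)"
    have s: "0 < s" "s * norm v = 1" using \<open>v \<noteq> 0\<close> by (auto simp: s_def)
    have A1: "A *v (s *\<^sub>R v) - s *\<^sub>R w = s *\<^sub>R (A *v v - w)"
      by (simp add: matrix_vector_mult_scaleR scaleR_diff_right)
    have A2: "(norm (A *v (s *\<^sub>R v) - s *\<^sub>R w))\<^sup>2 = s\<^sup>2 * (norm (A *v v - w))\<^sup>2"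
      unfolding A1 by (simp add: power_mult_distrib)
    have A3: "(s *\<^sub>R v) \<bullet> (H *v (s *\<^sub>R v)) = s\<^sup>2 * (v \<bullet> (H *v v))"
      by (simp add: matrix_vector_mult_scaleR power2_eq_square)
    have "s\<^sup>2 * (v \<bullet> (H *v v) + real (Suc n) * (norm (A *v v - w))\<^sup>2)
        < s\<^sup>2 * (inverse (real (Suc n)) * (norm v)\<^sup>2)"
      using vw(3) s(1) by (intro mult_strict_left_mono) auto
    also have "s\<^sup>2 * (inverse (real (Suc n)) * (norm v)\<^sup>2) = inverse (real (Suc n)) * (s * norm v)\<^sup>2"
      by (simp add: power_mult_distrib)
    finally have "(s *\<^sub>R v) \<bullet> (H *v (s *\<^sub>R v)) + real (Suc n) * (norm (A *v (s *\<^sub>R v) - s *\<^sub>R w))\<^sup>2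
        < inverse (real (Suc n))"
      unfolding A2 A3 s(2) by (simp add: algebra_simps)
    moreover have "s *\<^sub>R v \<in> V" using V vw(1) by (rule subspace_scale)
    moreover have "norm (s *\<^sub>R v) = 1" using s by simp
    moreover have "s *\<^sub>R w \<in> K" using K(2) vw(2) s(1) by blast
    ultimately show ?thesis by blast
  qed
  then have "\<forall>n. \<exists>p. fst p \<in> V \<and> norm (fst p) = 1 \<and> snd p \<in> K \<and>
      fst p \<bullet> (H *v fst p) + real (Suc n) * (norm (A *v fst p - snd p))\<^sup>2 < inverse (real (Suc n))"
    by (metis fst_conv snd_conv)
  from choice[OF this] obtain p where p: "\<And>n. fst (p n) \<in> V" "\<And>n. norm (fst (p n)) = 1"
    "\<And>n. snd (p n) \<in> K"
    "\<And>n. fst (p n) \<bullet> (H *v fst (p n)) + real (Suc n) * (norm (A *v fst (p n) - snd (p n)))\<^sup>2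
        < inverse (real (Suc n))"
    by blast
  have "compact (V \<inter> sphere 0 1)"
    using closed_Int_compact[OF closed_subspace[OF V] compact_sphere] .
  moreover have "\<forall>n. fst (p n) \<in> V \<inter> sphere 0 1" using p(1,2) by simp
  ultimately obtain u r where u: "u \<in> V \<inter> sphere 0 1" and r: "strict_mono r"
    and lim: "((\<lambda>n. fst (p n)) \<circ> r) \<longlonglongrightarrow> u"
    unfolding compact_def by metis
  define U where "U = (\<lambda>n. fst (p (r n)))"
  define W where "W = (\<lambda>n. snd (p (r n)))"
  have limU: "U \<longlonglongrightarrow> u" using lim by (simp add: U_def comp_def)
  have limHU: "(\<lambda>n. U n \<bullet> (H *v U n)) \<longlonglongrightarrow> u \<bullet> (H *v u)"
    by (intro tendsto_inner limU bounded_linear.tendsto[OF matrix_vector_mul_bounded_linear limU])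
  have inv: "(\<lambda>n. inverse (real (Suc (r n)))) \<longlonglongrightarrow> 0"
    using LIMSEQ_subseq_LIMSEQ[OF LIMSEQ_inverse_real_of_nat r] by (simp add: comp_def)
  have Wle: "(norm (A *v U n - W n))\<^sup>2
      \<le> inverse (real (Suc (r n))) * (inverse (real (Suc (r n))) - U n \<bullet> (H *v U n))" for n
  proof -
    have "real (Suc (r n)) * (norm (A *v U n - W n))\<^sup>2
        \<le> inverse (real (Suc (r n))) - U n \<bullet> (H *v U n)"
      using p(4)[of "r n"] unfolding U_def W_def by linarith
    then have "inverse (real (Suc (r n))) * (real (Suc (r n)) * (norm (A *v U n - W n))\<^sup>2)
        \<le> inverse (real (Suc (r n))) * (inverse (real (Suc (r n))) - U n \<bullet> (H *v U n))"
      by (rule mult_left_mono) simp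
    moreover have "inverse (real (Suc k)) * (real (Suc k) * q) = q" for q k
      by (simp del: of_nat_Suc add: mult.assoc[symmetric])
    ultimately show ?thesis by (simp only:)
  qed
  have "(\<lambda>n. inverse (real (Suc (r n))) * (inverse (real (Suc (r n))) - U n \<bullet> (H *v U n)))
      \<longlonglongrightarrow> 0 * (0 - u \<bullet> (H *v u))"
    by (intro tendsto_intros inv limHU)
  then have bnd: "(\<lambda>n. inverse (real (Suc (r n))) * (inverse (real (Suc (r n))) - U n \<bullet> (H *v U n)))
      \<longlonglongrightarrow> 0"
    by (simp only: mult_zero_left)
  have "(\<lambda>n. (norm (A *v U n - W n))\<^sup>2) \<longlonglongrightarrow> 0"
  proof (rule tendsto_sandwich[OF _ _ tendsto_const bnd])
    show "\<forall>\<^sub>F n in sequentially. 0 \<le> (norm (A *v U n - W n))\<^sup>2" by simp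
    show "\<forall>\<^sub>F n in sequentially. (norm (A *v U n - W n))\<^sup>2
        \<le> inverse (real (Suc (r n))) * (inverse (real (Suc (r n))) - U n \<bullet> (H *v U n))"
      by (rule always_eventually, rule allI, rule Wle)
  qed
  then have "(\<lambda>n. norm (A *v U n - W n)) \<longlonglongrightarrow> 0"
    using tendsto_real_sqrt by fastforce
  then have "(\<lambda>n. A *v U n - W n) \<longlonglongrightarrow> 0" by (rule tendsto_norm_zero_cancel)
  moreover have "(\<lambda>n. A *v U n) \<longlonglongrightarrow> A *v u"
    by (rule bounded_linear.tendsto[OF matrix_vector_mul_bounded_linear limU])
  ultimately have "(\<lambda>n. A *v U n - (A *v U n - W n)) \<longlonglongrightarrow> A *v u - 0"
    by (intro tendsto_diff)
  then have "W \<longlonglongrightarrow> A *v u" by simp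
  moreover have "\<And>n. W n \<in> K" using p(3) by (simp add: W_def)
  ultimately have "A *v u \<in> K" using closed_sequentially[OF K(1)] by blast
  moreover have "u \<noteq> 0" using u by auto
  ultimately have "0 < u \<bullet> (H *v u)" using pos u by blast
  moreover have "U n \<bullet> (H *v U n) \<le> inverse (real (Suc (r n)))" for n
  proof -
    have "0 \<le> real (Suc (r n)) * (norm (A *v U n - W n))\<^sup>2" by simp
    then show ?thesis using p(4)[of "r n"] unfolding U_def W_def by linarith
  qed
  then have "u \<bullet> (H *v u) \<le> 0" by (intro LIMSEQ_le[OF limHU inv]) blast
  ultimately show False by linarith
qed

lemma differentiable_gradient_local_bounds:
  fixes F :: "real^'n \<Rightarrow> real^'n"
  assumes "(F has_derivative (\<lambda>h. H *v h)) (at x)" "0 < \<epsilon>"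
  obtains r B where "0 < r" "0 < B"
    "\<And>z. norm (z - x) < r \<Longrightarrow>
       (z - x) \<bullet> (H *v (z - x)) - \<epsilon> * (norm (z - x))\<^sup>2 \<le> (F z - F x) \<bullet> (z - x)"
    "\<And>z. norm (z - x) < r \<Longrightarrow> norm (F z - F x) \<le> B * norm (z - x)"
proof -
  obtain r where r: "0 < r" "\<And>z. norm (z - x) < r \<Longrightarrow> norm (F z - F x - H *v (z - x)) \<le> \<epsilon> * norm (z - x)"
    using assms unfolding has_derivative_at_alt by blast
  obtain B where B: "0 < B" "\<And>h. norm (H *v h) \<le> B * norm h"
    using linear_bounded_pos[OF matrix_vector_mul_linear[of H]] by blast
  have lower: "(z - x) \<bullet> (H *v (z - x)) - \<epsilon> * (norm (z - x))\<^sup>2 \<le> (F z - F x) \<bullet> (z - x)"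
    if z: "norm (z - x) < r" for z
  proof -
    have "\<bar>(F z - F x - H *v (z - x)) \<bullet> (z - x)\<bar> \<le> norm (F z - F x - H *v (z - x)) * norm (z - x)"
      by (rule Cauchy_Schwarz_ineq2)
    also have "\<dots> \<le> \<epsilon> * norm (z - x) * norm (z - x)" using r(2)[OF z] by (rule mult_right_mono) simp
    finally have "\<bar>(F z - F x - H *v (z - x)) \<bullet> (z - x)\<bar> \<le> \<epsilon> * (norm (z - x))\<^sup>2"
      by (simp add: power2_eq_square mult.assoc)
    then show ?thesis
      unfolding inner_diff_left[of "F z - F x"] using inner_commute[of "z - x" "H *v (z - x)"] by linarith
  qed
  have upper: "norm (F z - F x) \<le> (\<epsilon> + B) * norm (z - x)" if z: "norm (z - x) < r" for z
    using r(2)[OF z] B(2)[of "z - x"] norm_triangle_ineq2[of "F z - F x" "H *v (z - x)"]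
    unfolding distrib_right by linarith
  show ?thesis
    using that[OF r(1) add_pos_pos[OF assms(2) B(1)] lower upper] .
qed

section \<open>Multipliers and optimality conditions\<close>

lemma kkt_iff:
  fixes A :: "real^'n^'m"
  shows "kkt A C gradf g x l \<longleftrightarrow>
     - (gradf x + transpose A *v l) \<in> normal_cone C x \<and> l \<in> subdifferential g (A *v x)"
proof -
  have "0 \<in> (+) a ` S \<longleftrightarrow> - a \<in> S" for a and S :: "(real^'n) set"
    by (auto simp: image_iff) (metis add.inverse_inverse add_eq_0_iff)+
  then show ?thesis unfolding kkt_def by (simp only:)
qed

text \<open>The multipliers are the points that an affine map sends into a product of two normal cones, to
  the epigraph of \<open>g\<close> and to \<open>C\<close>; Hoffman's bound for this preimage measures the distance to them by
  the residual of the stationarity equation.\<close>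

lemma multiplier_error_bound:
  fixes A :: "real^'n^'m" and g :: "real^'m \<Rightarrow> ereal"
  assumes C: "polyhedron C" and g: "polyhedral_convex_fun g" and kkt: "kkt A C gradf g xbar lbar"
  shows "closed {l. kkt A C gradf g xbar l}"
    and "\<exists>M\<ge>0. \<forall>l\<in>subdifferential g (A *v xbar). \<forall>n\<in>normal_cone C xbar.
           infdist l {l. kkt A C gradf g xbar l} \<le> M * norm (gradf xbar + transpose A *v l + n)"
proof -
  let ?E = "ereal_epigraph g" and ?L = "{l. kkt A C gradf g xbar l}"
  obtain c where c: "g (A *v xbar) = ereal c"
    using kkt subdifferential_finite unfolding kkt_def by blast
  define Q where "Q = normal_cone ?E (A *v xbar, c) \<times> normal_cone C xbar"
  define T where "T l = ((l, 0::real), - (transpose A *v l))" for l :: "real^'m"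
  let ?c = "((0, -1), - gradf xbar)"
  have T: "T l + ?c = ((l, -1), - (gradf xbar + transpose A *v l))" for l
    by (simp add: T_def)
  have L: "?L = {l. T l + ?c \<in> Q}"
    unfolding T Q_def kkt_iff by (auto simp only: subdifferential_iff_normal_cone[of g, OF c] mem_Times_iff fst_conv snd_conv)
  have lin: "linear T"
    unfolding linear_iff T_def
    by (simp add: matrix_vector_right_distrib matrix_vector_mult_scaleR)
  have "(A *v xbar, c) \<in> ?E" using c by (simp add: ereal_epigraph_def)
  moreover have "polyhedron ?E" using g by (simp add: polyhedral_convex_fun_def)
  moreover have "xbar \<in> C" using kkt unfolding kkt_iff mem_normal_cone by blast
  ultimately have Q: "polyhedron Q"
    unfolding Q_def by (intro polyhedron_Times polyhedron_normal_cone C)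
  show "closed ?L" unfolding L by (intro polyhedron_imp_closed polyhedron_affine_vimage lin Q)
  have "{l. T l + ?c \<in> Q} \<noteq> {}" using kkt unfolding L[symmetric] by blast
  from Hoffman_affine_vimage[OF lin Q this]
  obtain M where M: "M \<ge> 0" "\<And>l q. q \<in> Q \<Longrightarrow> infdist l ?L \<le> M * norm (T l + ?c - q)"
    unfolding L by blast
  have "infdist l ?L \<le> M * norm (gradf xbar + transpose A *v l + n)"
    if "l \<in> subdifferential g (A *v xbar)" "n \<in> normal_cone C xbar" for l n
  proof -
    have "((l, -1), n) \<in> Q"
      using that subdifferential_iff_normal_cone[of g "A *v xbar" c] c by (simp add: Q_def)
    moreover have "T l + ?c - ((l, -1), n) = (0, - (gradf xbar + transpose A *v l + n))"
      unfolding T by (simp add: zero_prod_def algebra_simps)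
    then have "norm (T l + ?c - ((l, -1), n)) = norm (gradf xbar + transpose A *v l + n)"
      by (simp add: norm_Pair norm_minus_commute del: minus_add_distrib)
    ultimately show ?thesis using M(2) by metis
  qed
  then show "\<exists>M\<ge>0. \<forall>l\<in>subdifferential g (A *v xbar). \<forall>n\<in>normal_cone C xbar.
           infdist l ?L \<le> M * norm (gradf xbar + transpose A *v l + n)"
    using M(1) by blast
qed

lemma nonneg_of_small_perturbation:
  fixes a b :: real
  assumes "\<And>t. 0 < t \<Longrightarrow> t \<le> 1 \<Longrightarrow> 0 \<le> a + t * b"
  shows "0 \<le> a"
proof -
  have "((\<lambda>t. a + t * b) \<longlongrightarrow> a + 0 * b) (at_right 0)" by (intro tendsto_intros)
  moreover have "\<forall>\<^sub>F t in at_right 0. 0 \<le> a + t * b"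
    using eventually_at_right_real[OF zero_less_one] by eventually_elim (use assms in auto)
  ultimately show ?thesis
    using tendsto_lowerbound[OF _ _ trivial_limit_at_right_real, of "\<lambda>t. a + t * b" "a + 0 * b" 0 0]
    by simp
qed

text \<open>A negative derivative towards a point of \<open>C\<close> would contradict minimality along the segment.\<close>

lemma arg_min_normal_cone:
  fixes C :: "'a::real_inner set"
  assumes "convex C" and m: "is_arg_min \<phi> (\<lambda>u. u \<in> C) x" and d: "GDERIV \<phi> x :> d"
  shows "- d \<in> normal_cone C x"
proof -
  have x: "x \<in> C" and le: "\<And>u. u \<in> C \<Longrightarrow> \<phi> x \<le> \<phi> u"
    using m by (auto simp: is_arg_min_def not_less)
  have "(- d) \<bullet> (z - x) \<le> 0" if z: "z \<in> C" for z
  proof -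
    have "((\<lambda>t. x + t *\<^sub>R (z - x)) has_derivative (\<lambda>t. t *\<^sub>R (z - x))) (at 0)"
      by (auto intro!: derivative_eq_intros)
    moreover have "(\<phi> has_derivative (\<lambda>h. h \<bullet> d)) (at (x + 0 *\<^sub>R (z - x)))"
      using d by (simp add: gderiv_def)
    ultimately have "((\<lambda>t. \<phi> (x + t *\<^sub>R (z - x))) has_derivative (\<lambda>t. (t *\<^sub>R (z - x)) \<bullet> d)) (at 0)"
      by (rule has_derivative_compose)
    then have D: "((\<lambda>t. \<phi> (x + t *\<^sub>R (z - x))) has_real_derivative ((z - x) \<bullet> d)) (at 0)"
      by (simp add: has_field_derivative_def mult_commute_abs)
    have "0 \<le> (z - x) \<bullet> d"
    proof (rule ccontr)
      assume "\<not> ?thesis"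
      then obtain \<delta> where \<delta>: "\<delta> > 0" "\<And>h. 0 < h \<Longrightarrow> h < \<delta> \<Longrightarrow> \<phi> (x + (0 + h) *\<^sub>R (z - x)) < \<phi> (x + 0 *\<^sub>R (z - x))"
        using DERIV_neg_dec_right[OF D] by auto
      define t where "t = min 1 (\<delta> / 2)"
      have t: "0 < t" "t < \<delta>" "t \<le> 1" using \<delta>(1) by (auto simp: t_def)
      have "(1 - t) *\<^sub>R x + t *\<^sub>R z \<in> C" using t x z by (intro convexD[OF assms(1)]) auto
      then have "x + t *\<^sub>R (z - x) \<in> C" by (simp add: algebra_simps)
      then show False using le[of "x + t *\<^sub>R (z - x)"] \<delta>(2)[OF t(1,2)] by simp
    qed
    then show ?thesis by (simp add: inner_commute)
  qed
  then show ?thesis using x unfolding mem_normal_cone by blast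
qed

lemma transpose_inner:
  fixes A :: "real^'n^'m"
  shows "(transpose A *v v) \<bullet> h = v \<bullet> (A *v h)"
  using dot_lmul_matrix[of v A h] by (simp add: transpose_matrix_vector)

lemma GDERIV_augmented_lagrangian:
  fixes A :: "real^'n^'m"
  assumes "GDERIV f x :> d"
  shows "GDERIV (\<lambda>u. f u + l \<bullet> (A *v u) + \<beta> / 2 * (norm (A *v u - y))\<^sup>2) x
           :> d + transpose A *v (l + \<beta> *\<^sub>R (A *v x - y))"
proof -
  have f: "(f has_derivative (\<lambda>h. h \<bullet> d)) (at x)" using assms by (simp add: gderiv_def)
  have A: "((\<lambda>u. A *v u) has_derivative (\<lambda>h. A *v h)) (at x)"
    by (simp add: linear_imp_has_derivative)
  have "((\<lambda>u. f u + l \<bullet> (A *v u) + \<beta> / 2 * ((A *v u - y) \<bullet> (A *v u - y))) has_derivative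
      (\<lambda>h. h \<bullet> d + l \<bullet> (A *v h) + \<beta> / 2 * ((A *v x - y) \<bullet> (A *v h) + (A *v h) \<bullet> (A *v x - y)))) (at x)"
    by (auto intro!: derivative_eq_intros f A)
  moreover have "h \<bullet> d + l \<bullet> (A *v h) + \<beta> / 2 * ((A *v x - y) \<bullet> (A *v h) + (A *v h) \<bullet> (A *v x - y))
      = h \<bullet> (d + transpose A *v (l + \<beta> *\<^sub>R (A *v x - y)))" for h
  proof -
    have "h \<bullet> (transpose A *v v) = (A *v h) \<bullet> v" for v
      using transpose_inner[of A v h] by (simp only: inner_commute)
    then show ?thesis by (simp add: inner_add_right inner_commute[of _ "A *v h"])
  qed
  ultimately show ?thesis by (simp add: gderiv_def power2_norm_eq_inner)
qed

text \<open>Comparing a minimizer with the points of the segment towards a competitor, the quadratic term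
  contributes only its gradient to first order.\<close>

lemma prox_subdifferential:
  fixes g :: "'a::real_inner \<Rightarrow> ereal"
  assumes conv: "convex (ereal_epigraph g)" and ninf: "\<And>w. g w \<noteq> - \<infinity>" and ex: "g w0 = ereal d0"
    and m: "is_arg_min (\<lambda>w. g w + ereal (l \<bullet> (- w)) + ereal (\<beta> / 2 * (norm (z - w))\<^sup>2)) (\<lambda>w. True) y"
  shows "l + \<beta> *\<^sub>R (z - y) \<in> subdifferential g y"
proof -
  let ?\<phi> = "\<lambda>w. g w + ereal (l \<bullet> (- w)) + ereal (\<beta> / 2 * (norm (z - w))\<^sup>2)"
  have le: "?\<phi> y \<le> ?\<phi> w" for w using m by (auto simp: is_arg_min_def not_less)
  have "g y \<noteq> \<infinity>" using le[of w0] ex by auto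
  then obtain c where c: "g y = ereal c" using ninf[of y] by (cases "g y") auto
  have "c + (l + \<beta> *\<^sub>R (z - y)) \<bullet> (w - y) \<le> d" if d: "g w = ereal d" for w d
  proof -
    have "0 \<le> (d - c - (l + \<beta> *\<^sub>R (z - y)) \<bullet> (w - y)) + t * (\<beta> / 2 * (norm (w - y))\<^sup>2)"
      if t: "0 < t" "t \<le> 1" for t
    proof -
      define u where "u = w - y"
      have "(1 - t) *\<^sub>R (y, c) + t *\<^sub>R (w, d) \<in> ereal_epigraph g"
        using t c d by (intro convexD[OF conv]) (auto simp: ereal_epigraph_def)
      then have "g ((1 - t) *\<^sub>R y + t *\<^sub>R w) \<le> ereal ((1 - t) * c + t * d)"
        by (simp add: ereal_epigraph_def)
      moreover have "(1 - t) *\<^sub>R y + t *\<^sub>R w = y + t *\<^sub>R u" by (simp add: u_def algebra_simps)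
      ultimately have "g (y + t *\<^sub>R u) \<le> ereal ((1 - t) * c + t * d)" by simp
      moreover obtain b where b: "g (y + t *\<^sub>R u) = ereal b"
        using calculation ninf[of "y + t *\<^sub>R u"] by (cases "g (y + t *\<^sub>R u)") auto
      ultimately have "b \<le> (1 - t) * c + t * d" by simp
      moreover have "c + l \<bullet> (- y) + \<beta> / 2 * (norm (z - y))\<^sup>2
          \<le> b + l \<bullet> (- (y + t *\<^sub>R u)) + \<beta> / 2 * (norm (z - (y + t *\<^sub>R u)))\<^sup>2"
        using le[of "y + t *\<^sub>R u"] b c by simp
      moreover have N: "(norm (z - (y + t *\<^sub>R u)))\<^sup>2
          = (norm (z - y))\<^sup>2 - 2 * t * ((z - y) \<bullet> u) + t\<^sup>2 * (norm u)\<^sup>2"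
        unfolding power2_norm_eq_inner
        by (simp add: inner_diff_left inner_diff_right inner_add_left inner_add_right
            inner_commute power2_eq_square algebra_simps)
      moreover have "\<beta> / 2 * (norm (z - (y + t *\<^sub>R u)))\<^sup>2
          = \<beta> / 2 * (norm (z - y))\<^sup>2 - t * (\<beta> * ((z - y) \<bullet> u)) + t * (t * (\<beta> / 2 * (norm u)\<^sup>2))"
        unfolding N by (simp add: ring_distribs power2_eq_square)
      moreover have "l \<bullet> (- (y + t *\<^sub>R u)) = l \<bullet> (- y) - t * (l \<bullet> u)"
        by (simp add: inner_diff_right)
      moreover have "(1 - t) * c + t * d = c - t * c + t * d" by (simp add: algebra_simps)
      moreover have "t * (d - c - l \<bullet> u - \<beta> * ((z - y) \<bullet> u) + t * (\<beta> / 2 * (norm u)\<^sup>2))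
          = t * d - t * c - t * (l \<bullet> u) - t * (\<beta> * ((z - y) \<bullet> u)) + t * (t * (\<beta> / 2 * (norm u)\<^sup>2))"
        by (simp add: ring_distribs)
      ultimately have "0 \<le> t * (d - c - l \<bullet> u - \<beta> * ((z - y) \<bullet> u) + t * (\<beta> / 2 * (norm u)\<^sup>2))"
        by linarith
      then have "0 \<le> d - c - l \<bullet> u - \<beta> * ((z - y) \<bullet> u) + t * (\<beta> / 2 * (norm u)\<^sup>2)"
        using t(1) by (simp add: zero_le_mult_iff)
      then show ?thesis unfolding u_def[symmetric] by (simp add: inner_add_left)
    qed
    from nonneg_of_small_perturbation[OF this] show ?thesis by simp
  qed
  then have "g y + ereal ((l + \<beta> *\<^sub>R (z - y)) \<bullet> (w - y)) \<le> g w" for w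
    using c ninf[of w] by (cases "g w") auto
  then show ?thesis using c by (simp add: subdifferential_def)
qed

section \<open>One step of the method\<close>

text \<open>The first-order optimality conditions of both subproblems. The membership \<open>l \<in> \<partial>g(y)\<close> is
  inherited from the preceding step or, initially, from the choice of the starting pair.\<close>

definition admm_step ::
  "real^'n^'m \<Rightarrow> (real^'n) set \<Rightarrow> (real^'n \<Rightarrow> real^'n) \<Rightarrow> (real^'m \<Rightarrow> ereal) \<Rightarrow> real
     \<Rightarrow> real^'m \<Rightarrow> real^'m \<Rightarrow> real^'n \<Rightarrow> real^'m \<Rightarrow> real^'m \<Rightarrow> bool" where
  "admm_step A C gradf g \<beta> y l x' y' l' \<longleftrightarrow>
     - (gradf x' + transpose A *v (l + \<beta> *\<^sub>R (A *v x' - y))) \<in> normal_cone C x' \<and>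
     l' = l + \<beta> *\<^sub>R (A *v x' - y') \<and>
     l \<in> subdifferential g y \<and> l' \<in> subdifferential g y'"

text \<open>Fejer monotonicity with respect to every multiplier, up to the monotonicity defect of the
  gradient. It is the sum of the monotonicity inequalities of the normal cone of \<open>C\<close>, of \<open>\<partial>g\<close>
  against the solution, and of \<open>\<partial>g\<close> along two successive iterates; the last one disposes of
  the cross term between the two parts of the step.\<close>

lemma admm_step_Fejer:
  fixes A :: "real^'n^'m"
  assumes "0 < \<beta>" and kkt: "kkt A C gradf g xbar ls"
    and step: "admm_step A C gradf g \<beta> y l x' y' l'"
  shows "\<beta> * (norm (y' - A *v xbar))\<^sup>2 + (norm (l' - ls))\<^sup>2 / \<beta>
      + 2 * ((gradf x' - gradf xbar) \<bullet> (x' - xbar))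
      + \<beta> * (norm (y' - y))\<^sup>2 + (norm (l' - l))\<^sup>2 / \<beta>
    \<le> \<beta> * (norm (y - A *v xbar))\<^sup>2 + (norm (l - ls))\<^sup>2 / \<beta>"
proof -
  have n: "- (gradf x' + transpose A *v (l + \<beta> *\<^sub>R (A *v x' - y))) \<in> normal_cone C x'"
    and l': "l' = l + \<beta> *\<^sub>R (A *v x' - y')"
    and l: "l \<in> subdifferential g y" and l'_sub: "l' \<in> subdifferential g y'"
    using step unfolding admm_step_def by blast+
  define a where "a = A *v (x' - xbar)"
  define e where "e = y' - A *v xbar"
  define L where "L = l' - ls"
  define dy where "dy = y' - y"
  define dl where "dl = l' - l"
  define \<gamma> where "\<gamma> = (gradf x' - gradf xbar) \<bullet> (x' - xbar)"
  have dl_eq: "dl = \<beta> *\<^sub>R (a - e)"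
    by (simp add: dl_def a_def e_def l' matrix_vector_mult_diff_distrib)
  have shift: "l + \<beta> *\<^sub>R (A *v x' - y) = l' + \<beta> *\<^sub>R dy"
    by (simp add: l' dy_def algebra_simps)
  have ks: "- (gradf xbar + transpose A *v ls) \<in> normal_cone C xbar"
    and ls: "ls \<in> subdifferential g (A *v xbar)" using kkt unfolding kkt_iff by auto
  have "- (gradf x' + transpose A *v (l' + \<beta> *\<^sub>R dy)) \<bullet> (xbar - x') \<le> 0"
    using n ks unfolding shift mem_normal_cone by blast
  then have 1: "gradf x' \<bullet> (x' - xbar) + (l' + \<beta> *\<^sub>R dy) \<bullet> a \<le> 0"
    unfolding a_def transpose_inner[symmetric] by (simp add: inner_add_left inner_diff_left inner_diff_right)
  have "- (gradf xbar + transpose A *v ls) \<bullet> (x' - xbar) \<le> 0"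
    using n ks unfolding mem_normal_cone by blast
  then have 2: "0 \<le> gradf xbar \<bullet> (x' - xbar) + ls \<bullet> a"
    unfolding a_def transpose_inner[symmetric] by (simp add: inner_add_left inner_diff_left inner_diff_right)
  have h1: "\<gamma> + L \<bullet> a + \<beta> * (dy \<bullet> a) \<le> 0"
    using 1 2 by (simp add: \<gamma>_def L_def inner_diff_left inner_add_left)
  have h2: "0 \<le> L \<bullet> e"
    using subdifferential_monotone[OF l'_sub ls] by (simp add: L_def e_def)
  have "0 \<le> dl \<bullet> dy"
    using subdifferential_monotone[OF l'_sub l] by (simp add: dl_def dy_def)
  then have "0 \<le> \<beta> * (a \<bullet> dy - e \<bullet> dy)" by (simp add: dl_eq inner_diff_left)
  then have h3: "\<beta> * (dy \<bullet> e) \<le> \<beta> * (dy \<bullet> a)"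
    unfolding inner_commute[of dy] by (simp add: right_diff_distrib)
  have Ldl: "2 * (L \<bullet> dl) / \<beta> = 2 * (L \<bullet> a) - 2 * (L \<bullet> e)"
    unfolding dl_eq using \<open>0 < \<beta>\<close> by (simp add: inner_diff_right field_simps)
  have expand: "(norm (p - q))\<^sup>2 = (norm p)\<^sup>2 - 2 * (p \<bullet> q) + (norm q)\<^sup>2" for p q :: "real^'m"
    unfolding power2_norm_eq_inner
    by (simp add: inner_diff_left inner_diff_right inner_commute[of q p])
  have "\<beta> * (norm (e - dy))\<^sup>2 = \<beta> * (norm e)\<^sup>2 - 2 * (\<beta> * (dy \<bullet> e)) + \<beta> * (norm dy)\<^sup>2"
    unfolding expand inner_commute[of e dy] by (simp add: algebra_simps)
  moreover have "(norm (L - dl))\<^sup>2 / \<beta> = (norm L)\<^sup>2 / \<beta> - 2 * (L \<bullet> dl) / \<beta> + (norm dl)\<^sup>2 / \<beta>"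
    unfolding expand by (simp add: diff_divide_distrib add_divide_distrib)
  moreover have "y - A *v xbar = e - dy" "l - ls = L - dl"
    by (simp_all add: e_def dy_def L_def dl_def)
  ultimately show ?thesis
    unfolding \<gamma>_def[symmetric] e_def[symmetric] L_def[symmetric] dy_def[symmetric] dl_def[symmetric]
    using h1 h2 h3 Ldl by simp
qed

lemma sum_power2_le: "(p + q)\<^sup>2 \<le> 2 * p\<^sup>2 + 2 * (q::real)\<^sup>2"
proof -
  have "2 * p\<^sup>2 + 2 * q\<^sup>2 - (p + q)\<^sup>2 = (p - q)\<^sup>2" by (simp add: power2_eq_square algebra_simps)
  then show ?thesis using zero_le_power2[of "p - q"] by linarith
qed

lemma subspace_parallel_space:
  assumes "x \<in> C" shows "subspace (parallel_space C)"
  unfolding parallel_space_eq[OF assms]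
  by (intro affine_diffs_subspace_subtract affine_affine_hull hull_inc assms)

lemma diff_in_parallel_space:
  assumes "x \<in> C" "z \<in> C" shows "z - x \<in> parallel_space C"
  unfolding parallel_space_eq[OF assms(1)] using hull_inc[OF assms(2)] by blast

text \<open>The infimum is attained at the Euclidean projection of \<open>l\<close>, as the weights act on the two
  components separately.\<close>

lemma dist_beta_Times:
  fixes L :: "'a::euclidean_space set"
  assumes "closed L" "L \<noteq> {}" "0 < \<beta>"
  shows "dist_beta \<beta> (y, l) ({a} \<times> L) = sqrt (\<beta> * (norm (y - a))\<^sup>2 + (infdist l L)\<^sup>2 / \<beta>)"
proof -
  have nb: "norm_beta \<beta> ((y, l) - (a, m)) = sqrt (\<beta> * (norm (y - a))\<^sup>2 + (dist l m)\<^sup>2 / \<beta>)" for m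
    by (simp add: norm_beta_def dist_norm)
  obtain m where m: "m \<in> L" "infdist l L = dist l m"
    using infdist_attains_inf[OF assms(1,2)] by blast
  show ?thesis
    unfolding dist_beta_def
  proof (rule cInf_eq_minimum)
    show "sqrt (\<beta> * (norm (y - a))\<^sup>2 + (infdist l L)\<^sup>2 / \<beta>)
        \<in> (\<lambda>w. norm_beta \<beta> ((y, l) - w)) ` ({a} \<times> L)"
      unfolding m(2) nb[symmetric] using m(1) by blast
    fix z assume "z \<in> (\<lambda>w. norm_beta \<beta> ((y, l) - w)) ` ({a} \<times> L)"
    then obtain m' where m': "m' \<in> L" "z = norm_beta \<beta> ((y, l) - (a, m'))" by blast
    have "(infdist l L)\<^sup>2 \<le> (dist l m')\<^sup>2"
      by (intro power_mono infdist_le m'(1) infdist_nonneg)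
    then have "(infdist l L)\<^sup>2 / \<beta> \<le> (dist l m')\<^sup>2 / \<beta>"
      using assms(3) by (intro divide_right_mono) auto
    then show "sqrt (\<beta> * (norm (y - a))\<^sup>2 + (infdist l L)\<^sup>2 / \<beta>) \<le> z"
      unfolding m'(2) nb by simp
  qed
qed

text \<open>The local analysis of one step. While the iterates stay near the solution, \<open>y' - A *v xbar\<close>
  lies in the critical cone, so the second-order condition with penalty \<open>b\<close> bounds the
  monotonicity defect of the gradient by \<open>b\<close> times the squared primal residual
  \<open>(norm (l' - l))\<^sup>2 / \<beta>\<^sup>2\<close>, and Fejer monotonicity absorbs it as soon as \<open>\<beta> > 2 * b\<close>. Hoffman's bound
  then shows that the decrease is proportional to the new squared distance.\<close>

lemma admm_local_contraction:
  fixes A :: "real^'n^'m" and g :: "real^'m \<Rightarrow> ereal" and hess :: "real^'n^'n"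
    and gradf :: "real^'n \<Rightarrow> real^'n" and C :: "(real^'n) set" and xbar :: "real^'n"
  defines "D \<equiv> \<lambda>\<beta> y l. (dist_beta \<beta> (y, l) ({A *v xbar} \<times> {l. kkt A C gradf g xbar l}))\<^sup>2"
  assumes C: "polyhedron C" and g: "polyhedral_convex_fun g" and kkt: "kkt A C gradf g xbar lbar"
    and hess: "(gradf has_derivative (\<lambda>h. hess *v h)) (at xbar)"
    and pd: "pos_def_on hess (parallel_space C \<inter> S_space_pre A g xbar lbar)"
  shows "\<exists>b>0. \<forall>\<beta>>2 * b. \<exists>r>0. \<exists>\<rho>>0. \<exists>\<kappa>>0. \<exists>M>0. \<forall>x' y l y' l'.
    admm_step A C gradf g \<beta> y l x' y' l' \<longrightarrow> norm (x' - xbar) \<le> r \<longrightarrow>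
    \<beta>\<^sup>2 * (norm (y - A *v xbar))\<^sup>2 + (norm (l - lbar))\<^sup>2 \<le> \<rho>\<^sup>2 \<longrightarrow>
    \<beta>\<^sup>2 * (norm (y' - A *v xbar))\<^sup>2 + (norm (l' - lbar))\<^sup>2 \<le> \<rho>\<^sup>2 \<and>
    D \<beta> y' l' + \<kappa> * ((norm (x' - xbar))\<^sup>2 + (norm (y' - y))\<^sup>2 + (norm (l' - l))\<^sup>2)
      \<le> D \<beta> y l \<and>
    D \<beta> y' l' \<le> M * ((norm (x' - xbar))\<^sup>2 + (norm (y' - y))\<^sup>2 + (norm (l' - l))\<^sup>2)"
proof -
  let ?L = "{l. kkt A C gradf g xbar l}"
  have lbar: "lbar \<in> subdifferential g (A *v xbar)" and xC: "xbar \<in> C"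
    using kkt unfolding kkt_iff mem_normal_cone by auto
  obtain K rK where K: "closed K" "0 \<in> K" "\<And>w s. w \<in> K \<Longrightarrow> 0 < s \<Longrightarrow> s *\<^sub>R w \<in> K"
    "K \<subseteq> T_cone g (A *v xbar) lbar" and rK: "rK > 0"
    "\<And>y l. l \<in> subdifferential g y \<Longrightarrow> norm (y - A *v xbar) < rK \<Longrightarrow> norm (l - lbar) < rK \<Longrightarrow>
        l \<in> subdifferential g (A *v xbar) \<and> y - A *v xbar \<in> K"
    using subdifferential_graph_near[OF g lbar] by metis
  have pos: "0 < v \<bullet> (hess *v v)" if v: "v \<in> parallel_space C" "v \<noteq> 0" "A *v v \<in> K" for v
  proof -
    have "A *v v = A *v v - 0" by simp
    then have "v \<in> S_space_pre A g xbar lbar"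
      using v(3) K(2,4) unfolding S_space_pre_def S_space_def by blast
    then show ?thesis using pd v unfolding pos_def_on_def by blast
  qed
  have "\<exists>b c. 0 < b \<and> 0 < c \<and> (\<forall>v w. v \<in> parallel_space C \<longrightarrow> w \<in> K \<longrightarrow>
      c * (norm v)\<^sup>2 \<le> v \<bullet> (hess *v v) + b * (norm (A *v v - w))\<^sup>2)"
    by (rule penalized_form_coercive[OF subspace_parallel_space[OF xC] K(1)])
      (use K(3) pos in auto)
  then obtain b c where bc: "0 < b" "0 < c" "\<And>v w. v \<in> parallel_space C \<Longrightarrow> w \<in> K \<Longrightarrow>
      c * (norm v)\<^sup>2 \<le> v \<bullet> (hess *v v) + b * (norm (A *v v - w))\<^sup>2"
    by blast
  obtain r1 G where r1: "0 < r1" and G: "0 < G" and grad: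
    "\<And>z. norm (z - xbar) < r1 \<Longrightarrow> (z - xbar) \<bullet> (hess *v (z - xbar)) - c / 2 * (norm (z - xbar))\<^sup>2
        \<le> (gradf z - gradf xbar) \<bullet> (z - xbar)"
    "\<And>z. norm (z - xbar) < r1 \<Longrightarrow> norm (gradf z - gradf xbar) \<le> G * norm (z - xbar)"
    using differentiable_gradient_local_bounds[OF hess half_gt_zero[OF bc(2)]] by metis
  obtain r2 where r2: "0 < r2" "\<And>q. dist q xbar < r2 \<Longrightarrow> normal_cone C q \<subseteq> normal_cone C xbar"
    using normal_cone_subset_near[OF C xC] by blast
  have closedL: "closed ?L" by (rule multiplier_error_bound(1)[OF C g kkt])
  have neL: "?L \<noteq> {}" using kkt by blast
  obtain M0 where M0: "M0 \<ge> 0" "\<And>l n. l \<in> subdifferential g (A *v xbar) \<Longrightarrow> n \<in> normal_cone C xbar \<Longrightarrow>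
      infdist l ?L \<le> M0 * norm (gradf xbar + transpose A *v l + n)"
    using multiplier_error_bound(2)[OF C g kkt] by blast
  obtain a where a: "a > 0" "\<And>h. norm (A *v h) \<le> a * norm h"
    using linear_bounded_pos[OF matrix_vector_mul_linear[of A]] by blast
  obtain a' where a': "a' > 0" "\<And>h. norm (transpose A *v h) \<le> a' * norm h"
    using linear_bounded_pos[OF matrix_vector_mul_linear[of "transpose A"]] by blast
  show ?thesis
  proof (rule exI[of _ b], rule conjI[OF bc(1)], rule allI, rule impI)
    fix \<beta> :: real assume \<beta>: "2 * b < \<beta>"
    then have \<beta>0: "0 < \<beta>" using bc(1) by linarith
    have D: "D \<beta> y l = \<beta> * (norm (y - A *v xbar))\<^sup>2 + (infdist l ?L)\<^sup>2 / \<beta>" for y l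
      unfolding D_def dist_beta_Times[OF closedL neL \<beta>0] using \<beta>0 by simp
    \<comment> \<open>\<open>s\<close> is the radius \<open>\<rho>\<close>. The new pair satisfies \<open>\<beta> |y' - A *v xbar| \<le> 2 s\<close> and
      \<open>|l' - lbar| \<le> 4 s\<close>, and both points have to stay within \<open>rK\<close>.\<close>
    define s where "s = rK * min 1 \<beta> / 8"
    have s: "0 < s" "8 * s \<le> rK" "8 * s \<le> rK * \<beta>"
      using rK(1) \<beta>0 by (auto simp: s_def min_def intro: mult_left_mono)
    define r where "r = min (s / (\<beta> * a)) (min (r1 / 2) (r2 / 2))"
    have r: "0 < r" "r < r1" "r < r2" "\<beta> * (a * r) \<le> s"
    proof -
      show "0 < r" "r < r1" "r < r2" using s(1) \<beta>0 a(1) r1 r2(1) by (auto simp: r_def)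
      have "r \<le> s / (\<beta> * a)" by (simp add: r_def)
      then show "\<beta> * (a * r) \<le> s" using \<beta>0 a(1) by (simp add: field_simps)
    qed
    define \<kappa> where "\<kappa> = min c (min \<beta> (1 / \<beta> - 2 * b / \<beta>\<^sup>2))"
    have "2 * b / \<beta>\<^sup>2 < \<beta> / \<beta>\<^sup>2" using \<beta> \<beta>0 by (intro divide_strict_right_mono) auto
    then have "0 < 1 / \<beta> - 2 * b / \<beta>\<^sup>2" using \<beta>0 by (simp add: power2_eq_square)
    then have \<kappa>: "0 < \<kappa>" "\<kappa> \<le> c" "\<kappa> \<le> \<beta>" "\<kappa> \<le> 1 / \<beta> - 2 * b / \<beta>\<^sup>2"
      using bc(2) \<beta>0 by (auto simp: \<kappa>_def)
    define m1 where "m1 = 2 * \<beta> * a\<^sup>2 + 2 * (M0 * G)\<^sup>2 / \<beta>"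
    define m2 where "m2 = 2 * (M0 * (\<beta> * a'))\<^sup>2 / \<beta>"
    define m3 where "m3 = 2 / \<beta>"
    define M where "M = m1 + m2 + m3"
    have m: "0 \<le> m1" "0 \<le> m2" "0 < m3" using \<beta>0 by (auto simp: m1_def m2_def m3_def)
    have M: "0 < M" "m1 \<le> M" "m2 \<le> M" "m3 \<le> M" using m by (auto simp: M_def)
    show "\<exists>r>0. \<exists>\<rho>>0. \<exists>\<kappa>>0. \<exists>M>0. \<forall>x' y l y' l'.
      admm_step A C gradf g \<beta> y l x' y' l' \<longrightarrow> norm (x' - xbar) \<le> r \<longrightarrow>
      \<beta>\<^sup>2 * (norm (y - A *v xbar))\<^sup>2 + (norm (l - lbar))\<^sup>2 \<le> \<rho>\<^sup>2 \<longrightarrow>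
      \<beta>\<^sup>2 * (norm (y' - A *v xbar))\<^sup>2 + (norm (l' - lbar))\<^sup>2 \<le> \<rho>\<^sup>2 \<and>
      D \<beta> y' l' + \<kappa> * ((norm (x' - xbar))\<^sup>2 + (norm (y' - y))\<^sup>2 + (norm (l' - l))\<^sup>2)
        \<le> D \<beta> y l \<and>
      D \<beta> y' l' \<le> M * ((norm (x' - xbar))\<^sup>2 + (norm (y' - y))\<^sup>2 + (norm (l' - l))\<^sup>2)"
    proof (rule exI[of _ r], rule conjI[OF r(1)], rule exI[of _ s], rule conjI[OF s(1)],
        rule exI[of _ \<kappa>], rule conjI[OF \<kappa>(1)], rule exI[of _ M], rule conjI[OF M(1)],
        intro allI impI conjI)
      fix x' y l y' l'
      assume step: "admm_step A C gradf g \<beta> y l x' y' l'"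
        and x': "norm (x' - xbar) \<le> r"
        and near: "\<beta>\<^sup>2 * (norm (y - A *v xbar))\<^sup>2 + (norm (l - lbar))\<^sup>2 \<le> s\<^sup>2"
      have n: "- (gradf x' + transpose A *v (l + \<beta> *\<^sub>R (A *v x' - y))) \<in> normal_cone C x'"
        and l': "l' = l + \<beta> *\<^sub>R (A *v x' - y')" and l'_sub: "l' \<in> subdifferential g y'"
        using step unfolding admm_step_def by blast+
      define ex where "ex = x' - xbar"
      define e where "e = y' - A *v xbar"
      have x'C: "x' \<in> C" using n unfolding mem_normal_cone by blast
      have Aex: "A *v x' - y' = A *v ex - e"
        by (simp add: ex_def e_def matrix_vector_mult_diff_distrib)
      have dl: "l' - l = \<beta> *\<^sub>R (A *v ex - e)" using l' Aex by simp
      have "(norm (l - lbar))\<^sup>2 \<le> s\<^sup>2"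
        using near mult_nonneg_nonneg[OF zero_le_power2[of \<beta>] zero_le_power2[of "norm (y - A *v xbar)"]]
        by linarith
      then have ls: "norm (l - lbar) \<le> s" using s(1) by (simp add: power2_le_iff_abs_le)
      have "\<beta> * norm (A *v ex) \<le> \<beta> * (a * r)"
        using a(2)[of ex] x' a(1) \<beta>0 unfolding ex_def[symmetric]
        by (intro mult_left_mono) (auto intro: order_trans mult_left_mono)
      then have Axs: "\<beta> * norm (A *v ex) \<le> s" using r(4) by linarith
      \<comment> \<open>The proximal step is nonexpansive, so the new \<open>y\<close> and multiplier stay close as well.\<close>
      have "0 \<le> (l' - lbar) \<bullet> e" using subdifferential_monotone[OF l'_sub lbar] by (simp add: e_def)
      moreover have "l' - lbar = (l - lbar) + \<beta> *\<^sub>R (A *v ex) - \<beta> *\<^sub>R e"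
        using l' Aex by (simp add: algebra_simps)
      ultimately have "\<beta> * (norm e)\<^sup>2 \<le> (l - lbar) \<bullet> e + (\<beta> *\<^sub>R (A *v ex)) \<bullet> e"
        by (simp add: inner_diff_left inner_add_left power2_norm_eq_inner)
      also have "\<dots> \<le> norm (l - lbar) * norm e + norm (\<beta> *\<^sub>R (A *v ex)) * norm e"
        by (intro add_mono norm_cauchy_schwarz)
      also have "\<dots> \<le> s * norm e + s * norm e"
        using ls Axs \<beta>0 by (intro add_mono mult_right_mono) auto
      finally have "(\<beta> * norm e) * norm e \<le> (2 * s) * norm e" by (simp add: power2_eq_square)
      then have es: "\<beta> * norm e \<le> 2 * s"
        using s(1) by (cases "norm e = 0") (auto simp: mult_le_cancel_right)
      have "\<beta> * norm e < rK * \<beta>" using es s by linarith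
      then have e_rK: "norm (y' - A *v xbar) < rK" using \<beta>0 by (simp add: e_def mult.commute)
      have "norm (l' - lbar) \<le> norm (l - lbar) + \<beta> * norm (A *v ex) + \<beta> * norm e"
      proof -
        have "norm (l' - lbar) \<le> norm ((l - lbar) + \<beta> *\<^sub>R (A *v ex)) + norm (\<beta> *\<^sub>R e)"
          unfolding \<open>l' - lbar = (l - lbar) + \<beta> *\<^sub>R (A *v ex) - \<beta> *\<^sub>R e\<close> by (rule norm_triangle_ineq4)
        moreover have "norm ((l - lbar) + \<beta> *\<^sub>R (A *v ex)) \<le> norm (l - lbar) + norm (\<beta> *\<^sub>R (A *v ex))"
          by (rule norm_triangle_ineq)
        ultimately show ?thesis using \<beta>0 by simp
      qed
      then have "norm (l' - lbar) < rK" using ls Axs es s by linarith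
      from rK(2)[OF l'_sub e_rK this]
      have l'_bar: "l' \<in> subdifferential g (A *v xbar)" and eK: "e \<in> K" by (auto simp: e_def)
      have exV: "ex \<in> parallel_space C" unfolding ex_def by (rule diff_in_parallel_space[OF xC x'C])
      have x'r1: "norm (x' - xbar) < r1" using x' r(2) by linarith
      define \<gamma> where "\<gamma> = (gradf x' - gradf xbar) \<bullet> (x' - xbar)"
      have ndl: "(norm (A *v ex - e))\<^sup>2 = (norm (l' - l))\<^sup>2 / \<beta>\<^sup>2"
        unfolding dl using \<beta>0 by (simp add: power_mult_distrib)
      have "c / 2 * (norm ex)\<^sup>2 - b * (norm (A *v ex - e))\<^sup>2 \<le> \<gamma>"
        using bc(3)[OF exV eK] grad(1)[OF x'r1] unfolding ex_def[symmetric] \<gamma>_def by linarith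
      then have \<gamma>: "c * (norm ex)\<^sup>2 - 2 * b / \<beta>\<^sup>2 * (norm (l' - l))\<^sup>2 \<le> 2 * \<gamma>"
        unfolding ndl by simp
      have "\<kappa> * (norm ex)\<^sup>2 \<le> c * (norm ex)\<^sup>2" "\<kappa> * (norm (y' - y))\<^sup>2 \<le> \<beta> * (norm (y' - y))\<^sup>2"
        "\<kappa> * (norm (l' - l))\<^sup>2 \<le> (1 / \<beta> - 2 * b / \<beta>\<^sup>2) * (norm (l' - l))\<^sup>2"
        using \<kappa> by (auto intro!: mult_right_mono)
      then have decr: "\<kappa> * ((norm ex)\<^sup>2 + (norm (y' - y))\<^sup>2 + (norm (l' - l))\<^sup>2)
          \<le> 2 * \<gamma> + \<beta> * (norm (y' - y))\<^sup>2 + (norm (l' - l))\<^sup>2 / \<beta>"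
        using \<gamma> by (simp add: distrib_left left_diff_distrib)
      have Fejer: "\<beta> * (norm e)\<^sup>2 + (norm (l' - ls))\<^sup>2 / \<beta>
            + \<kappa> * ((norm ex)\<^sup>2 + (norm (y' - y))\<^sup>2 + (norm (l' - l))\<^sup>2)
          \<le> \<beta> * (norm (y - A *v xbar))\<^sup>2 + (norm (l - ls))\<^sup>2 / \<beta>" if "kkt A C gradf g xbar ls" for ls
        using admm_step_Fejer[OF \<beta>0 that step] decr
        unfolding \<gamma>_def e_def by linarith
      have R0: "0 \<le> \<kappa> * ((norm ex)\<^sup>2 + (norm (y' - y))\<^sup>2 + (norm (l' - l))\<^sup>2)"
        using \<kappa>(1) by simp
      have "\<beta> * (norm e)\<^sup>2 + (norm (l' - lbar))\<^sup>2 / \<beta>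
          \<le> \<beta> * (norm (y - A *v xbar))\<^sup>2 + (norm (l - lbar))\<^sup>2 / \<beta>"
        using Fejer[OF kkt] R0 by linarith
      then have "\<beta> * (\<beta> * (norm e)\<^sup>2 + (norm (l' - lbar))\<^sup>2 / \<beta>)
          \<le> \<beta> * (\<beta> * (norm (y - A *v xbar))\<^sup>2 + (norm (l - lbar))\<^sup>2 / \<beta>)"
        using \<beta>0 by (intro mult_left_mono) auto
      then have "\<beta>\<^sup>2 * (norm e)\<^sup>2 + (norm (l' - lbar))\<^sup>2
          \<le> \<beta>\<^sup>2 * (norm (y - A *v xbar))\<^sup>2 + (norm (l - lbar))\<^sup>2"
        using \<beta>0 by (simp add: distrib_left power2_eq_square mult.assoc)
      then show "\<beta>\<^sup>2 * (norm (y' - A *v xbar))\<^sup>2 + (norm (l' - lbar))\<^sup>2 \<le> s\<^sup>2"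
        using near unfolding e_def by linarith
      \<comment> \<open>Fejer monotonicity with respect to the projection of \<open>l\<close> gives the decrease of the distance.\<close>
      obtain ls where ls_L: "ls \<in> ?L" "infdist l ?L = dist l ls"
        using infdist_attains_inf[OF closedL neL] by blast
      have "(infdist l' ?L)\<^sup>2 \<le> (norm (l' - ls))\<^sup>2"
        using infdist_le[OF ls_L(1), of l'] infdist_nonneg by (intro power_mono) (auto simp: dist_norm)
      then have "(infdist l' ?L)\<^sup>2 / \<beta> \<le> (norm (l' - ls))\<^sup>2 / \<beta>"
        using \<beta>0 by (intro divide_right_mono) auto
      then show "D \<beta> y' l' + \<kappa> * ((norm (x' - xbar))\<^sup>2 + (norm (y' - y))\<^sup>2 + (norm (l' - l))\<^sup>2)
          \<le> D \<beta> y l"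
        using Fejer[of ls] ls_L unfolding D ex_def[symmetric] e_def[symmetric]
        by (simp add: dist_norm)
      \<comment> \<open>The normal vector of the \<open>x\<close>-step is an admissible perturbation of stationarity at \<open>xbar\<close>.\<close>
      define n' where "n' = - (gradf x' + transpose A *v (l + \<beta> *\<^sub>R (A *v x' - y)))"
      have "dist x' xbar < r2" using x' r(3) by (simp add: dist_norm)
      then have "n' \<in> normal_cone C xbar" using n r2(2) unfolding n'_def by blast
      note res = M0(2)[OF l'_bar this]
      have "l + \<beta> *\<^sub>R (A *v x' - y) = l' + \<beta> *\<^sub>R (y' - y)" unfolding l' by (simp add: algebra_simps)
      then have "gradf xbar + transpose A *v l' + n'
          = - ((gradf x' - gradf xbar) + \<beta> *\<^sub>R (transpose A *v (y' - y)))"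
        unfolding n'_def by (simp only: matrix_vector_right_distrib matrix_vector_mult_scaleR) simp
      then have "norm (gradf xbar + transpose A *v l' + n')
          = norm ((gradf x' - gradf xbar) + \<beta> *\<^sub>R (transpose A *v (y' - y)))"
        by (simp only: norm_minus_cancel)
      also have "\<dots> \<le> norm (gradf x' - gradf xbar) + norm (\<beta> *\<^sub>R (transpose A *v (y' - y)))"
        by (rule norm_triangle_ineq)
      also have "\<dots> \<le> G * norm ex + \<beta> * (a' * norm (y' - y))"
        using grad(2)[OF x'r1] a'(2)[of "y' - y"] \<beta>0 unfolding ex_def
        by (intro add_mono) (auto intro: mult_left_mono)
      finally have "M0 * norm (gradf xbar + transpose A *v l' + n')
          \<le> M0 * (G * norm ex + \<beta> * (a' * norm (y' - y)))" using M0(1) by (rule mult_left_mono)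
      with res have "infdist l' ?L \<le> (M0 * G) * norm ex + (M0 * (\<beta> * a')) * norm (y' - y)"
        by (simp add: algebra_simps)
      then have "(infdist l' ?L)\<^sup>2 \<le> ((M0 * G) * norm ex + (M0 * (\<beta> * a')) * norm (y' - y))\<^sup>2"
        using infdist_nonneg by (intro power_mono) auto
      also have "\<dots> \<le> 2 * ((M0 * G) * norm ex)\<^sup>2 + 2 * ((M0 * (\<beta> * a')) * norm (y' - y))\<^sup>2"
        by (rule sum_power2_le)
      finally have "(infdist l' ?L)\<^sup>2 / \<beta>
          \<le> (2 * ((M0 * G) * norm ex)\<^sup>2 + 2 * ((M0 * (\<beta> * a')) * norm (y' - y))\<^sup>2) / \<beta>"
        using \<beta>0 by (intro divide_right_mono) auto
      then have d1: "(infdist l' ?L)\<^sup>2 / \<beta>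
          \<le> 2 * (M0 * G)\<^sup>2 / \<beta> * (norm ex)\<^sup>2 + m2 * (norm (y' - y))\<^sup>2"
        unfolding power_mult_distrib[of _ "norm ex"] power_mult_distrib[of _ "norm (y' - y)"]
        by (simp add: m2_def add_divide_distrib mult.assoc)
      have "norm e \<le> a * norm ex + norm (A *v ex - e)"
        using norm_triangle_ineq4[of "A *v ex" "A *v ex - e"] a(2)[of ex] by simp
      then have "(norm e)\<^sup>2 \<le> (a * norm ex + norm (A *v ex - e))\<^sup>2" by (intro power_mono) auto
      also have "\<dots> \<le> 2 * (a * norm ex)\<^sup>2 + 2 * (norm (A *v ex - e))\<^sup>2" by (rule sum_power2_le)
      finally have "\<beta> * (norm e)\<^sup>2 \<le> \<beta> * (2 * (a * norm ex)\<^sup>2 + 2 * (norm (A *v ex - e))\<^sup>2)"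
        using \<beta>0 by (intro mult_left_mono) auto
      also have "\<dots> = 2 * \<beta> * a\<^sup>2 * (norm ex)\<^sup>2 + m3 * (norm (l' - l))\<^sup>2"
        unfolding ndl m3_def using \<beta>0 by (simp add: power_mult_distrib field_simps power2_eq_square)
      finally have d2: "\<beta> * (norm e)\<^sup>2 \<le> 2 * \<beta> * a\<^sup>2 * (norm ex)\<^sup>2 + m3 * (norm (l' - l))\<^sup>2" .
      have "D \<beta> y' l' \<le> m1 * (norm ex)\<^sup>2 + m2 * (norm (y' - y))\<^sup>2 + m3 * (norm (l' - l))\<^sup>2"
        using d1 d2 unfolding D e_def[symmetric] m1_def by (simp add: distrib_right)
      also have "\<dots> \<le> M * (norm ex)\<^sup>2 + M * (norm (y' - y))\<^sup>2 + M * (norm (l' - l))\<^sup>2"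
        using M by (intro add_mono mult_right_mono) auto
      finally show "D \<beta> y' l'
          \<le> M * ((norm (x' - xbar))\<^sup>2 + (norm (y' - y))\<^sup>2 + (norm (l' - l))\<^sup>2)"
        unfolding ex_def by (simp add: distrib_left)
    qed
  qed
qed

section \<open>Rates of convergence\<close>

lemma Q_linearI:
  fixes z :: "nat \<Rightarrow> 'a::real_normed_vector"
  assumes q: "0 < q" "q < 1" and step: "\<And>k. norm (z (Suc k) - zs) \<le> q * norm (z k - zs)"
  shows "Q_linear z zs"
proof -
  have geo: "norm (z k - zs) \<le> q ^ k * norm (z 0 - zs)" for k
  proof (induction k)
    case (Suc k)
    have "norm (z (Suc k) - zs) \<le> q * (q ^ k * norm (z 0 - zs))"
      using step[of k] Suc q(1) by (meson mult_left_mono less_imp_le order_trans)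
    then show ?case by simp
  qed simp
  have "(\<lambda>k. q ^ k * norm (z 0 - zs)) \<longlonglongrightarrow> 0 * norm (z 0 - zs)"
    using q by (intro tendsto_intros LIMSEQ_power_zero) auto
  then have "(\<lambda>k. q ^ k * norm (z 0 - zs)) \<longlonglongrightarrow> 0" by (simp only: mult_zero_left)
  then have "(\<lambda>k. z k - zs) \<longlonglongrightarrow> 0"
    by (rule Lim_null_comparison[rotated]) (simp add: geo)
  then have "z \<longlonglongrightarrow> zs" by (simp add: LIM_zero_iff)
  moreover have "ereal (norm (z (Suc k) - zs)) / ereal (norm (z k - zs)) \<le> ereal q" for k
  proof (cases "norm (z k - zs) = 0")
    case True
    then have "norm (z (Suc k) - zs) = 0"
      using step[of k] norm_ge_zero[of "z (Suc k) - zs"] by simp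
    then show ?thesis using q(1) by simp
  next
    case False
    then have "0 < norm (z k - zs)" by simp
    then show ?thesis using step[of k] by (simp add: pos_divide_le_eq)
  qed
  then have "limsup (\<lambda>k. ereal (norm (z (Suc k) - zs)) / ereal (norm (z k - zs))) \<le> ereal q"
    by (intro Limsup_bounded) simp
  ultimately show ?thesis unfolding Q_linear_def using q by blast
qed

lemma R_linearI:
  fixes z :: "nat \<Rightarrow> 'a::real_normed_vector"
  assumes q: "0 < q" "q < 1" and "0 \<le> B"
    and bound: "\<forall>\<^sub>F k in sequentially. norm (z k - zs) \<le> B * q ^ k"
  shows "R_linear z zs"
  unfolding R_linear_def
proof (intro exI[of _ "\<lambda>k. B * q ^ k"] conjI allI)
  show "0 \<le> B * q ^ k" for k using q \<open>0 \<le> B\<close> by simp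
  show "Q_linear (\<lambda>k. B * q ^ k) 0"
    using q \<open>0 \<le> B\<close> by (intro Q_linearI[OF q]) simp
  show "\<forall>\<^sub>F k in sequentially. norm (z k - zs) \<le> B * q ^ k" by (rule bound)
qed

lemma LIMSEQ_geometric_bound:
  fixes z :: "nat \<Rightarrow> 'a::real_normed_vector"
  assumes "0 < q" "q < 1" and bound: "\<forall>\<^sub>F k in sequentially. norm (z k - zs) \<le> B * q ^ k"
  shows "z \<longlonglongrightarrow> zs"
proof -
  have "(\<lambda>k. B * q ^ k) \<longlonglongrightarrow> B * 0"
    using assms by (intro tendsto_intros LIMSEQ_power_zero) auto
  then have "(\<lambda>k. B * q ^ k) \<longlonglongrightarrow> 0" by (simp only: mult_zero_right)
  from Lim_null_comparison[OF bound this] show ?thesis by (simp add: LIM_zero_iff)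
qed

lemma convergent_of_geometric_steps:
  fixes z :: "nat \<Rightarrow> 'a::banach"
  assumes "0 < q" "q < 1" and bound: "\<And>k. norm (z (Suc k) - z k) \<le> B * q ^ k"
  shows "convergent z"
proof -
  have "summable (\<lambda>k. B * q ^ k)" using assms by (intro summable_mult summable_geometric) auto
  then have "summable (\<lambda>k. z (Suc k) - z k)"
    by (rule summable_comparison_test') (rule bound)
  then have "convergent (\<lambda>n. z n - z 0)"
    unfolding summable_iff_convergent sum_lessThan_telescope .
  then obtain w where "(\<lambda>n. z n - z 0) \<longlonglongrightarrow> w" unfolding convergent_def by blast
  then have "(\<lambda>n. z n - z 0 + z 0) \<longlonglongrightarrow> w + z 0" by (intro tendsto_intros)
  then show ?thesis unfolding convergent_def by auto
qed

text \<open>The interplay of decrease and error bound: a decrease proportional to \<open>e\<close> that controls the new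
  value forces a contraction, and then \<open>e\<close> inherits the geometric rate.\<close>

lemma decrease_error_bound_rate:
  fixes d e :: "nat \<Rightarrow> real"
  assumes \<kappa>: "0 < \<kappa>" and M: "0 < M" and d: "\<And>k. 0 \<le> d k"
    and decr: "\<And>k. (d (Suc k))\<^sup>2 + \<kappa> * e k \<le> (d k)\<^sup>2" and eb: "\<And>k. (d (Suc k))\<^sup>2 \<le> M * e k"
  obtains q where "0 < q" "q < 1" "\<And>k. d (Suc k) \<le> q * d k" "\<And>k. d k \<le> d 0 * q ^ k"
    "\<And>k. e k \<le> (d 0 * q ^ k)\<^sup>2 / \<kappa>"
proof -
  define q where "q = sqrt (M / (M + \<kappa>))"
  have q: "0 < q" "q < 1" using \<kappa> M by (auto simp: q_def)
  have q2: "q\<^sup>2 = M / (M + \<kappa>)" using \<kappa> M by (simp add: q_def)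
  have step: "d (Suc k) \<le> q * d k" for k
  proof -
    have "\<kappa> * (d (Suc k))\<^sup>2 \<le> \<kappa> * (M * e k)" using eb \<kappa> by (intro mult_left_mono) auto
    moreover have "M * ((d (Suc k))\<^sup>2 + \<kappa> * e k) \<le> M * (d k)\<^sup>2" using decr M by (intro mult_left_mono) auto
    ultimately have "(M + \<kappa>) * (d (Suc k))\<^sup>2 \<le> M * (d k)\<^sup>2" by (simp add: algebra_simps)
    then have "(d (Suc k))\<^sup>2 \<le> (q * d k)\<^sup>2"
      unfolding power_mult_distrib q2 using M \<kappa> by (simp add: field_simps)
    moreover have "0 \<le> q * d k" using d q(1) by simp
    ultimately show ?thesis by (rule power2_le_imp_le)
  qed
  have geo: "d k \<le> d 0 * q ^ k" for k
  proof (induction k)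
    case (Suc k)
    have "d (Suc k) \<le> q * (d 0 * q ^ k)"
      using step[of k] Suc q(1) by (meson mult_left_mono less_imp_le order_trans)
    then show ?case by (simp add: mult_ac)
  qed simp
  have "e k \<le> (d 0 * q ^ k)\<^sup>2 / \<kappa>" for k
  proof -
    have "\<kappa> * e k \<le> (d k)\<^sup>2" using decr[of k] zero_le_power2[of "d (Suc k)"] by linarith
    also have "\<dots> \<le> (d 0 * q ^ k)\<^sup>2" using geo d by (intro power_mono) auto
    finally show ?thesis using \<kappa> by (simp add: field_simps)
  qed
  from that[OF q step geo this] show ?thesis .
qed

theorem proposition12:
  fixes A :: "real^'n^'m"
    and C :: "(real^'n) set"
    and f :: "real^'n \<Rightarrow> real"
    and gradf :: "real^'n \<Rightarrow> real^'n"
    and hessf :: "real^'n \<Rightarrow> real^'n^'n"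
    and g :: "real^'m \<Rightarrow> ereal"
    and xbar :: "real^'n"
    and lbar :: "real^'m"
    and U :: "(real^'n) set"
  assumes "polyhedron C" and "C \<noteq> {}"
    and "\<And>x. GDERIV f x :> gradf x" and "continuous_on UNIV gradf"
    and "polyhedral_convex_fun g"
    and "eff_dom g \<inter> (*v) A ` rel_interior C \<noteq> {}"
    and "kkt A C gradf g xbar lbar"
    and "convex U" and "xbar \<in> interior U"
    and "\<And>x. x \<in> U \<Longrightarrow> (gradf has_derivative (\<lambda>h. hessf x *v h)) (at x)"
    and "continuous_on U hessf"
    and "pos_def_on (hessf xbar) (parallel_space C \<inter> S_space_pre A g xbar lbar)"
  shows "\<exists>\<beta>0>0. \<forall>\<beta>>2 * \<beta>0. \<exists>X L \<rho>.
    closed X \<and> convex X \<and> xbar \<in> interior X \<and>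
    closed L \<and> convex L \<and> lbar \<in> interior L \<and>
    \<rho> > 0 \<and> cball lbar \<rho> \<subseteq> interior L \<and>
    (\<forall>x y l.
       admm A C f g \<beta> x y l \<and>
       l 0 \<in> subdifferential g (y 0) \<and>
       \<beta>\<^sup>2 * (norm (y 0 - A *v xbar))\<^sup>2 + (norm (l 0 - lbar))\<^sup>2 \<le> \<rho>\<^sup>2 \<and>
       (\<forall>k\<ge>1. x k \<in> X) \<longrightarrow>
       (let Lstar = {l' \<in> L. kkt A C gradf g xbar l'};
            v = (\<lambda>k. (y k, l k));
            Vstar = {A *v xbar} \<times> Lstar
        in x \<longlonglongrightarrow> xbar \<and> y \<longlonglongrightarrow> A *v xbar \<and>
           (\<exists>lhat \<in> Lstar \<inter> cball lbar \<rho>. l \<longlonglongrightarrow> lhat) \<and>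
           Q_linear (\<lambda>k. dist_beta \<beta> (v k) Vstar) 0 \<and>
           R_linear (\<lambda>k. infdist (v k) Vstar) 0 \<and>
           R_linear x xbar))"
proof -
  let ?L = "{l. kkt A C gradf g xbar l}"
  define V where "V = {A *v xbar} \<times> ?L"
  have "xbar \<in> U" using assms(9) interior_subset by blast
  note hess = assms(10)[OF this]
  have closedL: "closed ?L" by (rule multiplier_error_bound(1)[OF assms(1,5,7)])
  have neL: "?L \<noteq> {}" using assms(7) by blast
  have convC: "convex C" using assms(1) by (rule polyhedron_imp_convex)
  have gE: "convex (ereal_epigraph g)" "\<And>w. g w \<noteq> - \<infinity>"
    using assms(5) by (auto simp: polyhedral_convex_fun_def)
  obtain c0 where c0: "g (A *v xbar) = ereal c0"
    using assms(7) subdifferential_finite unfolding kkt_def by blast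
  obtain b where b: "0 < b" and contr: "\<And>\<beta>. 2 * b < \<beta> \<Longrightarrow>
    \<exists>r>0. \<exists>\<rho>>0. \<exists>\<kappa>>0. \<exists>M>0. \<forall>x' y l y' l'.
    admm_step A C gradf g \<beta> y l x' y' l' \<longrightarrow> norm (x' - xbar) \<le> r \<longrightarrow>
    \<beta>\<^sup>2 * (norm (y - A *v xbar))\<^sup>2 + (norm (l - lbar))\<^sup>2 \<le> \<rho>\<^sup>2 \<longrightarrow>
    \<beta>\<^sup>2 * (norm (y' - A *v xbar))\<^sup>2 + (norm (l' - lbar))\<^sup>2 \<le> \<rho>\<^sup>2 \<and>
    (dist_beta \<beta> (y', l') V)\<^sup>2 + \<kappa> * ((norm (x' - xbar))\<^sup>2 + (norm (y' - y))\<^sup>2 + (norm (l' - l))\<^sup>2)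
      \<le> (dist_beta \<beta> (y, l) V)\<^sup>2 \<and>
    (dist_beta \<beta> (y', l') V)\<^sup>2 \<le> M * ((norm (x' - xbar))\<^sup>2 + (norm (y' - y))\<^sup>2 + (norm (l' - l))\<^sup>2)"
    using admm_local_contraction[OF assms(1,5,7) hess assms(12), folded V_def] by blast
  show ?thesis
  proof (rule exI[of _ b], rule conjI[OF b], rule allI, rule impI)
    fix \<beta> assume \<beta>b: "2 * b < \<beta>"
    then have \<beta>: "0 < \<beta>" using b by linarith
    obtain r \<rho> \<kappa> M where r: "0 < r" and \<rho>: "0 < \<rho>" and \<kappa>: "0 < \<kappa>" and M: "0 < M"
      and step: "\<And>x' y l y' l'.
    admm_step A C gradf g \<beta> y l x' y' l' \<Longrightarrow> norm (x' - xbar) \<le> r \<Longrightarrow>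
    \<beta>\<^sup>2 * (norm (y - A *v xbar))\<^sup>2 + (norm (l - lbar))\<^sup>2 \<le> \<rho>\<^sup>2 \<Longrightarrow>
    \<beta>\<^sup>2 * (norm (y' - A *v xbar))\<^sup>2 + (norm (l' - lbar))\<^sup>2 \<le> \<rho>\<^sup>2 \<and>
    (dist_beta \<beta> (y', l') V)\<^sup>2 + \<kappa> * ((norm (x' - xbar))\<^sup>2 + (norm (y' - y))\<^sup>2 + (norm (l' - l))\<^sup>2)
      \<le> (dist_beta \<beta> (y, l) V)\<^sup>2 \<and>
    (dist_beta \<beta> (y', l') V)\<^sup>2 \<le> M * ((norm (x' - xbar))\<^sup>2 + (norm (y' - y))\<^sup>2 + (norm (l' - l))\<^sup>2)"
      using contr[OF \<beta>b] by metis
    have main: "x \<longlonglongrightarrow> xbar \<and> y \<longlonglongrightarrow> A *v xbar \<and>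
           (\<exists>lhat \<in> ?L \<inter> cball lbar \<rho>. l \<longlonglongrightarrow> lhat) \<and>
           Q_linear (\<lambda>k. dist_beta \<beta> (y k, l k) V) 0 \<and>
           R_linear (\<lambda>k. infdist (y k, l k) V) 0 \<and> R_linear x xbar"
      if admm: "admm A C f g \<beta> x y l" and l0: "l 0 \<in> subdifferential g (y 0)"
        and start: "\<beta>\<^sup>2 * (norm (y 0 - A *v xbar))\<^sup>2 + (norm (l 0 - lbar))\<^sup>2 \<le> \<rho>\<^sup>2"
        and X: "\<And>k. 1 \<le> k \<Longrightarrow> x k \<in> cball xbar r" for x y l
    proof -
      have n: "- (gradf (x (Suc k)) + transpose A *v (l k + \<beta> *\<^sub>R (A *v x (Suc k) - y k)))
          \<in> normal_cone C (x (Suc k))" for k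
        using admm unfolding admm_def
        by (intro arg_min_normal_cone[OF convC _ GDERIV_augmented_lagrangian[OF assms(3)]]) blast
      have lS: "l (Suc k) = l k + \<beta> *\<^sub>R (A *v x (Suc k) - y (Suc k))" for k
        using admm unfolding admm_def by blast
      have lSub: "l (Suc k) \<in> subdifferential g (y (Suc k))" for k
        unfolding lS using admm unfolding admm_def
        by (intro prox_subdifferential[OF gE c0]) blast
      then have "l k \<in> subdifferential g (y k)" for k using l0 by (cases k) auto
      then have adm: "admm_step A C gradf g \<beta> (y k) (l k) (x (Suc k)) (y (Suc k)) (l (Suc k))" for k
        using n lS lSub unfolding admm_step_def by blast
      have xr: "norm (x (Suc k) - xbar) \<le> r" for k
        using X[of "Suc k"] by (simp add: dist_norm norm_minus_commute)
      have near: "\<beta>\<^sup>2 * (norm (y k - A *v xbar))\<^sup>2 + (norm (l k - lbar))\<^sup>2 \<le> \<rho>\<^sup>2" for k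
      proof (induction k)
        case (Suc k)
        from step[OF adm xr Suc] show ?case by blast
      qed (rule start)
      define d where "d k = dist_beta \<beta> (y k, l k) V" for k
      define e where "e k = (norm (x (Suc k) - xbar))\<^sup>2 + (norm (y (Suc k) - y k))\<^sup>2
        + (norm (l (Suc k) - l k))\<^sup>2" for k
      have d_eq: "d k = sqrt (\<beta> * (norm (y k - A *v xbar))\<^sup>2 + (infdist (l k) ?L)\<^sup>2 / \<beta>)" for k
        unfolding d_def V_def by (rule dist_beta_Times[OF closedL neL \<beta>])
      have d0: "0 \<le> d k" for k unfolding d_eq using \<beta> by simp
      have decr: "(d (Suc k))\<^sup>2 + \<kappa> * e k \<le> (d k)\<^sup>2" and eb: "(d (Suc k))\<^sup>2 \<le> M * e k" for k
        using step[OF adm xr near] unfolding d_def e_def by blast+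
      obtain q where q: "0 < q" "q < 1" and qd: "\<And>k. d (Suc k) \<le> q * d k"
        and geo: "\<And>k. d k \<le> d 0 * q ^ k" and ge: "\<And>k. e k \<le> (d 0 * q ^ k)\<^sup>2 / \<kappa>"
        using decrease_error_bound_rate[where d = d and e = e, OF \<kappa> M d0 decr eb] by blast
      define B where "B = d 0 / sqrt \<kappa>"
      have B0: "0 \<le> B" using d0 \<kappa> by (simp add: B_def)
      have sq: "a \<le> B * q ^ k" if "0 \<le> a" "a\<^sup>2 \<le> e k" for a k
      proof (rule power2_le_imp_le)
        have "(B * q ^ k)\<^sup>2 = (d 0 * q ^ k)\<^sup>2 / \<kappa>"
          using \<kappa> by (simp add: B_def power_mult_distrib power_divide)
        then show "a\<^sup>2 \<le> (B * q ^ k)\<^sup>2" using ge[of k] that(2) by simp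
        show "0 \<le> B * q ^ k" using B0 q by simp
      qed
      have "norm (x (Suc k) - xbar) \<le> B * q ^ k" for k by (rule sq) (simp_all add: e_def)
      then have "norm (x (Suc k) - xbar) \<le> (B / q) * q ^ Suc k" for k using q by simp
      then have "norm (x k - xbar) \<le> (B / q) * q ^ k" if "1 \<le> k" for k using that by (cases k) auto
      then have xrate: "\<forall>\<^sub>F k in sequentially. norm (x k - xbar) \<le> (B / q) * q ^ k"
        unfolding eventually_sequentially by blast
      have yd: "norm (y k - A *v xbar) \<le> d k / sqrt \<beta>" for k
      proof -
        have "sqrt \<beta> * norm (y k - A *v xbar) = sqrt (\<beta> * (norm (y k - A *v xbar))\<^sup>2)"
          by (simp add: real_sqrt_mult)
        also have "\<dots> \<le> d k" unfolding d_eq using \<beta> by simp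
        finally show ?thesis using \<beta> by (simp add: field_simps)
      qed
      have ld: "infdist (l k) ?L \<le> sqrt \<beta> * d k" for k
      proof -
        have "infdist (l k) ?L / sqrt \<beta> = sqrt ((infdist (l k) ?L)\<^sup>2 / \<beta>)"
          by (simp add: real_sqrt_divide infdist_nonneg)
        also have "\<dots> \<le> d k" unfolding d_eq using \<beta> by simp
        finally show ?thesis using \<beta> by (simp add: field_simps)
      qed
      have "norm (y k - A *v xbar) \<le> (d 0 / sqrt \<beta>) * q ^ k" for k
        using yd[of k] divide_right_mono[OF geo[of k], of "sqrt \<beta>"] \<beta> by simp
      then have ylim: "y \<longlonglongrightarrow> A *v xbar"
        by (intro LIMSEQ_geometric_bound[OF q] always_eventually) blast
      have lrate: "infdist (l k) ?L \<le> (sqrt \<beta> * d 0) * q ^ k" for k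
      proof -
        have "sqrt \<beta> * d k \<le> sqrt \<beta> * (d 0 * q ^ k)" using geo \<beta> by (intro mult_left_mono) auto
        then show ?thesis using ld[of k] by (simp only: mult.assoc)
      qed
      have "norm (l (Suc k) - l k) \<le> B * q ^ k" for k by (rule sq) (simp_all add: e_def)
      from convergent_of_geometric_steps[OF q this]
      obtain lhat where lhat: "l \<longlonglongrightarrow> lhat" unfolding convergent_def by blast
      have "(\<lambda>k. infdist (l k) ?L) \<longlonglongrightarrow> 0"
        using lrate
        by (intro LIMSEQ_geometric_bound[OF q, of _ _ "sqrt \<beta> * d 0"] always_eventually)
          (simp add: infdist_nonneg)
      moreover have "(\<lambda>k. infdist (l k) ?L) \<longlonglongrightarrow> infdist lhat ?L"
        by (intro tendsto_infdist lhat)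
      ultimately have "infdist lhat ?L = 0" by (metis LIMSEQ_unique)
      then have "lhat \<in> ?L" using in_closed_iff_infdist_zero[OF closedL neL] by blast
      moreover have "l k \<in> cball lbar \<rho>" for k
      proof -
        have "0 \<le> \<beta>\<^sup>2 * (norm (y k - A *v xbar))\<^sup>2" by simp
        then have "(norm (l k - lbar))\<^sup>2 \<le> \<rho>\<^sup>2" using near[of k] by linarith
        then have "norm (l k - lbar) \<le> \<rho>" using \<rho> by (simp add: power2_le_iff_abs_le)
        then show ?thesis by (simp add: dist_norm norm_minus_commute)
      qed
      then have "lhat \<in> cball lbar \<rho>" using closed_sequentially[OF closed_cball _ lhat] by blast
      moreover have "Q_linear d 0" using qd d0 by (intro Q_linearI[OF q]) simp
      moreover have "R_linear (\<lambda>k. infdist (y k, l k) V) 0"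
      proof (rule R_linearI[OF q, of "(1 / sqrt \<beta> + sqrt \<beta>) * d 0"])
        show "0 \<le> (1 / sqrt \<beta> + sqrt \<beta>) * d 0" using d0 \<beta> by simp
        have "infdist (y k, l k) V \<le> (1 / sqrt \<beta> + sqrt \<beta>) * d 0 * q ^ k" for k
        proof -
          obtain m where m: "m \<in> ?L" "infdist (l k) ?L = dist (l k) m"
            using infdist_attains_inf[OF closedL neL] by blast
          have "infdist (y k, l k) V \<le> dist (y k, l k) (A *v xbar, m)"
            using m(1) by (intro infdist_le) (simp add: V_def)
          also have "\<dots> \<le> dist (y k) (A *v xbar) + dist (l k) m"
            unfolding dist_Pair_Pair by (intro sqrt_sum_squares_le_sum) auto
          also have "\<dots> \<le> (1 / sqrt \<beta> + sqrt \<beta>) * d k"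
            using yd[of k] ld[of k] m(2) by (simp add: dist_norm distrib_right)
          also have "\<dots> \<le> (1 / sqrt \<beta> + sqrt \<beta>) * (d 0 * q ^ k)"
            using geo \<beta> by (intro mult_left_mono) auto
          finally show ?thesis by (simp only: mult.assoc)
        qed
        then show "\<forall>\<^sub>F k in sequentially. norm (infdist (y k, l k) V - 0)
            \<le> (1 / sqrt \<beta> + sqrt \<beta>) * d 0 * q ^ k"
          by (intro always_eventually) (simp add: infdist_nonneg)
      qed
      moreover have "R_linear x xbar" using B0 q by (intro R_linearI[OF q _ xrate]) simp
      ultimately show ?thesis
        using LIMSEQ_geometric_bound[OF q xrate] ylim lhat unfolding d_def by blast
    qed
    \<comment> \<open>The estimates hold for all multipliers at once, so the whole space serves as the dual
      neighbourhood.\<close>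
    show "\<exists>X L \<rho>.
      closed X \<and> convex X \<and> xbar \<in> interior X \<and>
      closed L \<and> convex L \<and> lbar \<in> interior L \<and>
      \<rho> > 0 \<and> cball lbar \<rho> \<subseteq> interior L \<and>
      (\<forall>x y l.
         admm A C f g \<beta> x y l \<and>
         l 0 \<in> subdifferential g (y 0) \<and>
         \<beta>\<^sup>2 * (norm (y 0 - A *v xbar))\<^sup>2 + (norm (l 0 - lbar))\<^sup>2 \<le> \<rho>\<^sup>2 \<and>
         (\<forall>k\<ge>1. x k \<in> X) \<longrightarrow>
         (let Lstar = {l' \<in> L. kkt A C gradf g xbar l'};
              v = (\<lambda>k. (y k, l k));
              Vstar = {A *v xbar} \<times> Lstar
          in x \<longlonglongrightarrow> xbar \<and> y \<longlonglongrightarrow> A *v xbar \<and>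
             (\<exists>lhat \<in> Lstar \<inter> cball lbar \<rho>. l \<longlonglongrightarrow> lhat) \<and>
             Q_linear (\<lambda>k. dist_beta \<beta> (v k) Vstar) 0 \<and>
             R_linear (\<lambda>k. infdist (v k) Vstar) 0 \<and>
             R_linear x xbar))"
    proof (rule exI[of _ "cball xbar r"], rule exI[of _ UNIV], rule exI[of _ \<rho>],
        intro conjI allI impI)
      have all: "{l' \<in> UNIV. kkt A C gradf g xbar l'} = ?L" by simp
      fix x y l
      assume "admm A C f g \<beta> x y l \<and> l 0 \<in> subdifferential g (y 0) \<and>
         \<beta>\<^sup>2 * (norm (y 0 - A *v xbar))\<^sup>2 + (norm (l 0 - lbar))\<^sup>2 \<le> \<rho>\<^sup>2 \<and>
         (\<forall>k\<ge>1. x k \<in> cball xbar r)"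
      then show "let Lstar = {l' \<in> UNIV. kkt A C gradf g xbar l'};
              v = (\<lambda>k. (y k, l k));
              Vstar = {A *v xbar} \<times> Lstar
          in x \<longlonglongrightarrow> xbar \<and> y \<longlonglongrightarrow> A *v xbar \<and>
             (\<exists>lhat \<in> Lstar \<inter> cball lbar \<rho>. l \<longlonglongrightarrow> lhat) \<and>
             Q_linear (\<lambda>k. dist_beta \<beta> (v k) Vstar) 0 \<and>
             R_linear (\<lambda>k. infdist (v k) Vstar) 0 \<and>
             R_linear x xbar"
        unfolding Let_def all V_def[symmetric] by (intro main) blast+
    qed (use r \<rho> in auto)
  qed
qed

end
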